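(* The following identities of $n\times n$ matrices over $\mathcal D'(n)\otimes U(\mathfrak{gl}(n))$ hold: $$C_\rho(\mathbf E_n+R_1-n)=0,\qquad C_\rho(\mathbf E_n^t-1+R_1)=0.$$
   Context: The base field is $\mathbb C$ and $n$ is a fixed positive integer. $E_{ij}$ are the elementary matrices; indices run over $1,\dots,n$ for $\mathfrak{gl}(n)$ and over $0,\dots,n$ for $\mathfrak{gl}(n+1)$. $\mathbf E_n$ is the $n\times n$ matrix with $(i,j)$ entry $E_{ij}\in U(\mathfrak{gl}(n))$ (viewed as $1\otimes E_{ij}$), and $\mathbf E_n^t$ its transpose. For a square matrix $A$ and an element or constant $v$, $A+v$ means the sum of $A$ and the scalar matrix with $v$ on the diagonal. $\mathcal D'(n)$ is the subalgebra of the algebra of differential operators on $\mathbb C[t_0^{\pm1},t_1,\dots,t_n]$ generated by $\frac{t_i}{t_0}$ ($1\le i\le n$) and $t_0\partial_j$ ($0\le j\le n$), where $\partial_j=\partial/\partial t_j$; $\mathcal E=\sum_{i=0}^n t_i\partial_i$. Put $G_1^{\mathfrak{gl}(n)}=\sum_{i=1}^nE_{ii}$ and $R_1=-\frac1{n+1}\left(\mathcal E\otimes1+1\otimes G_1^{\mathfrak{gl}(n)}\right)$, a central element of $\mathcal D'(n)\otimes U(\mathfrak{gl}(n))$. The map $\rho:U(\mathfrak{gl}(n+1))\to\mathcal D'(n)\otimes U(\mathfrak{gl}(n))$ is the homomorphism of associative unital algebras determined by $E_{ab}\mapsto t_a\partial_b\otimes1+1\otimes E_{ab}+\delta_{ab}R_1$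 for $a,b>0$; $E_{a0}\mapsto t_a\partial_0\otimes1-\sum_{i>0}\frac{t_i}{t_0}\otimes E_{ai}$ for $a>0$; $E_{0b}\mapsto t_0\partial_b\otimes1$ for $b>0$; $E_{00}\mapsto t_0\partial_0\otimes1+R_1$. Determinants are column determinants: for a matrix $A$ over an associative algebra with index set $0,\dots,n$, $\det(A)=\sum_{\sigma}\operatorname{sgn}(\sigma)A_{\sigma(0)0}A_{\sigma(1)1}\cdots A_{\sigma(n)n}$, over permutations $\sigma$ of $\{0,\dots,n\}$. $T$ is a formal variable commuting with all $E_{ij}$. The Capelli determinant $C_{n+1}(T)\in U(\mathfrak{gl}(n+1))[T]$ is the determinant of the $(n+1)\times(n+1)$ matrix with $(i,j)$ entry $E_{ij}-\delta_{ij}(T+i)$, $0\le i,j\le n$; its coefficients are central in $U(\mathfrak{gl}(n+1))$. $C_\rho(T)$ is the polynomial in $T$ over $\mathcal D'(n)\otimes U(\mathfrak{gl}(n))$ obtained from $C_{n+1}(T)$ by applying $\rho$ to its coefficients; these coefficients lie in $\mathbb C[\mathcal E]\otimes Z(\mathfrak{gl}(n))$, hence are central, so $C_\rho$ may be evaluated at square matrices over $\mathcal D'(n)\otimes U(\mathfrak{gl}(n))$. *)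

theory Defs
  imports
    "HOL-Analysis.Finite_Cartesian_Product"
    "HOL-Combinatorics.Permutations"
    "HOL-Library.Poly_Mapping"
    "HOL-Library.Product_Plus"
    "HOL-Library.Option_ord"
begin

(* The index set 1,...,n is a type 'n of class {finite, linorder}, with n = CARD('n) >= 1.
   The index set 0,...,n is 'n option, where None plays the role of 0 and, by Option_ord,
   None < Some i for all i. *)

section \<open>Associative unital algebras over the complex numbers\<close>

class complex_algebra_1 = ring_1 +
  fixes scaleC :: "complex \<Rightarrow> 'a \<Rightarrow> 'a"  (infixr \<open>*\<^sub>C\<close> 75)
  assumes scaleC_add_right: "c *\<^sub>C (x + y) = c *\<^sub>C x + c *\<^sub>C y"
    and scaleC_add_left: "(c + d) *\<^sub>C x = c *\<^sub>C x + d *\<^sub>C x"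
    and scaleC_scaleC: "c *\<^sub>C d *\<^sub>C x = (c * d) *\<^sub>C x"
    and scaleC_one: "1 *\<^sub>C x = x"
    and mult_scaleC_left: "(c *\<^sub>C x) * y = c *\<^sub>C (x * y)"
    and mult_scaleC_right: "x * (c *\<^sub>C y) = c *\<^sub>C (x * y)"

definition alg_hom :: "('a::complex_algebra_1 \<Rightarrow> 'b::complex_algebra_1) \<Rightarrow> bool" where
  "alg_hom h \<longleftrightarrow> h 1 = 1 \<and> (\<forall>x y. h (x + y) = h x + h y) \<and> (\<forall>x y. h (x * y) = h x * h y) \<and>
     (\<forall>c x. h (c *\<^sub>C x) = c *\<^sub>C h x)"


section \<open>Free algebras\<close>

(* The free monoid, written additively so that the convolution product of Poly_Mapping
   makes its complex monoid algebra the free associative algebra. *)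

datatype 'x fword = FWord (letters: "'x list")

instantiation fword :: (type) monoid_add
begin

definition zero_fword :: "'a fword" where
  "0 = FWord []"

definition plus_fword :: "'a fword \<Rightarrow> 'a fword \<Rightarrow> 'a fword" where
  "v + w = FWord (letters v @ letters w)"

instance
  by standard (simp_all add: zero_fword_def plus_fword_def)

end

type_synonym 'x free_algebra = "'x fword \<Rightarrow>\<^sub>0 complex"

definition free_gen :: "'x \<Rightarrow> 'x free_algebra" where
  "free_gen x = Poly_Mapping.single (FWord [x]) 1"


section \<open>The universal enveloping algebra of gl\<close>

(* The two-sided ideal generated by
   [E_ij, E_kl] - (delta_jk E_il - delta_li E_kj). *)

inductive_set gl_ideal :: "('i \<times> 'i) free_algebra set" where
  gl_rel: "free_gen (i, j) * free_gen (k, l) - free_gen (k, l) * free_gen (i, j)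
      - ((if j = k then free_gen (i, l) else 0) - (if l = i then free_gen (k, j) else 0))
    \<in> gl_ideal"
| gl_zero: "0 \<in> gl_ideal"
| gl_add: "x \<in> gl_ideal \<Longrightarrow> y \<in> gl_ideal \<Longrightarrow> x + y \<in> gl_ideal"
| gl_lmult: "x \<in> gl_ideal \<Longrightarrow> r * x \<in> gl_ideal"
| gl_rmult: "x \<in> gl_ideal \<Longrightarrow> x * r \<in> gl_ideal"

lemma gl_uminus: "x \<in> gl_ideal \<Longrightarrow> - x \<in> gl_ideal"
  using gl_lmult[of x "- 1"] by simp

lemma lookup_mult_0_fword:
  fixes p q :: "'x free_algebra"
  shows "Poly_Mapping.lookup (p * q) 0 = Poly_Mapping.lookup p 0 * Poly_Mapping.lookup q 0"
proof -
  have eq: "((0::'x fword) = v + w) \<longleftrightarrow> v = 0 \<and> w = 0" for v w :: "'x fword"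
    by (cases v; cases w) (auto simp: zero_fword_def plus_fword_def)
  have "(\<lambda>v. Poly_Mapping.lookup p v *
        Sum_any (\<lambda>w. Poly_Mapping.lookup q w when (0::'x fword) = v + w)) =
      (\<lambda>v. Poly_Mapping.lookup p v * Poly_Mapping.lookup q 0 when v = 0)" (is "?f = ?g")
  proof
    fix v show "?f v = ?g v"
      unfolding eq by (cases "v = 0") simp_all
  qed
  then have "Poly_Mapping.lookup (p * q) 0 = Sum_any ?g"
    by (simp only: lookup_mult)
  then show ?thesis
    by simp
qed

lemma single_0_central:
  fixes p :: "'m::monoid_add \<Rightarrow>\<^sub>0 complex"
  shows "p * Poly_Mapping.single 0 c = Poly_Mapping.single 0 c * p"
proof (induction p rule: update_induct)
  case const
  then show ?case by simp
next
  case (update f a b)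
  have "Poly_Mapping.update a b f = f + Poly_Mapping.single a b"
    using update by (intro poly_mapping_eqI)
      (auto simp: lookup_update lookup_add lookup_single when_def in_keys_iff)
  then show ?case
    using update by (simp add: distrib_left distrib_right mult_single mult.commute)
qed

lemma free_gen_lookup_0: "Poly_Mapping.lookup (free_gen x) 0 = 0"
  by (simp add: free_gen_def lookup_single zero_fword_def)

lemma gl_ideal_lookup_0: "x \<in> gl_ideal \<Longrightarrow> Poly_Mapping.lookup x 0 = 0"
  by (induction rule: gl_ideal.induct)
    (simp_all add: lookup_minus lookup_add lookup_mult_0_fword free_gen_lookup_0)

quotient_type 'i ugl = "('i \<times> 'i) free_algebra" / "\<lambda>p q. p - q \<in> gl_ideal"
proof (rule equivpI)
  show "reflp (\<lambda>p q. p - q \<in> (gl_ideal :: ('i \<times> 'i) free_algebra set))"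
    by (rule reflpI) (simp add: gl_zero)
  show "symp (\<lambda>p q. p - q \<in> (gl_ideal :: ('i \<times> 'i) free_algebra set))"
    by (rule sympI) (metis gl_uminus minus_diff_eq)
  show "transp (\<lambda>p q. p - q \<in> (gl_ideal :: ('i \<times> 'i) free_algebra set))"
  proof (rule transpI)
    fix p q r :: "('i \<times> 'i) free_algebra"
    assume "p - q \<in> gl_ideal" "q - r \<in> gl_ideal"
    from gl_add[OF this] show "p - r \<in> gl_ideal" by simp
  qed
qed

instantiation ugl :: (type) complex_algebra_1
begin

lift_definition zero_ugl :: "'a ugl" is 0 .
lift_definition one_ugl :: "'a ugl" is 1 .

lift_definition plus_ugl :: "'a ugl \<Rightarrow> 'a ugl \<Rightarrow> 'a ugl" is "(+)"
  by (metis add_diff_add gl_add)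

lift_definition uminus_ugl :: "'a ugl \<Rightarrow> 'a ugl" is "uminus"
  by (metis gl_uminus minus_diff_minus)

lift_definition minus_ugl :: "'a ugl \<Rightarrow> 'a ugl \<Rightarrow> 'a ugl" is "(-)"
proof -
  fix p q r s :: "('a \<times> 'a) free_algebra"
  assume "p - q \<in> gl_ideal" "r - s \<in> gl_ideal"
  then have "(p - q) + - (r - s) \<in> gl_ideal"
    by (intro gl_add gl_uminus)
  then show "p - r - (q - s) \<in> gl_ideal"
    by (simp add: algebra_simps)
qed

lift_definition times_ugl :: "'a ugl \<Rightarrow> 'a ugl \<Rightarrow> 'a ugl" is "(*)"
proof -
  fix p q r s :: "('a \<times> 'a) free_algebra"
  assume "p - q \<in> gl_ideal" "r - s \<in> gl_ideal"
  then have "(p - q) * r + q * (r - s) \<in> gl_ideal"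
    by (intro gl_add gl_lmult gl_rmult)
  then show "p * r - q * s \<in> gl_ideal"
    by (simp add: algebra_simps)
qed

lift_definition scaleC_ugl :: "complex \<Rightarrow> 'a ugl \<Rightarrow> 'a ugl" is "\<lambda>c p. Poly_Mapping.single 0 c * p"
  by (metis gl_lmult right_diff_distrib)

instance
proof
  fix x y z :: "'a ugl" and c d :: complex
  have central: "p * Poly_Mapping.single 0 c = Poly_Mapping.single 0 c * p"
    for p :: "('a \<times> 'a) free_algebra" and c
    by (rule single_0_central)
  show "x + y + z = x + (y + z)" by transfer (simp add: algebra_simps gl_zero)
  show "x + y = y + x" by transfer (simp add: algebra_simps gl_zero)
  show "0 + x = x" by transfer (simp add: gl_zero)
  show "- x + x = 0" by transfer (simp add: gl_zero)
  show "x - y = x + - y" by transfer (simp add: gl_zero)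
  show "x * y * z = x * (y * z)" by transfer (simp add: mult.assoc gl_zero)
  show "1 * x = x" by transfer (simp add: gl_zero)
  show "x * 1 = x" by transfer (simp add: gl_zero)
  show "(x + y) * z = x * z + y * z" by transfer (simp add: algebra_simps gl_zero)
  show "x * (y + z) = x * y + x * z" by transfer (simp add: algebra_simps gl_zero)
  show "(0::'a ugl) \<noteq> 1"
    by transfer (auto dest: gl_ideal_lookup_0)
  show "c *\<^sub>C (x + y) = c *\<^sub>C x + c *\<^sub>C y" by transfer (simp add: algebra_simps gl_zero)
  show "(c + d) *\<^sub>C x = c *\<^sub>C x + d *\<^sub>C x"
    by transfer (simp add: algebra_simps single_add gl_zero)
  show "c *\<^sub>C d *\<^sub>C x = (c * d) *\<^sub>C x"
    by transfer (simp add: mult.assoc[symmetric] mult_single gl_zero)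
  show "1 *\<^sub>C x = x" by transfer (simp add: gl_zero)
  show "(c *\<^sub>C x) * y = c *\<^sub>C (x * y)" by transfer (simp add: mult.assoc gl_zero)
  show "x * (c *\<^sub>C y) = c *\<^sub>C (x * y)"
    by transfer (metis central mult.assoc diff_self gl_zero)
qed

end

lift_definition E :: "'i \<Rightarrow> 'i \<Rightarrow> 'i ugl" is "\<lambda>i j. free_gen (i, j)" .


section \<open>The algebra of differential operators D'(n)\<close>

(* Laurent polynomials C[t_0, 1/t_0, t_1, ..., t_n] as the monoid algebra of Z x N^n:
   the key (k, m) stands for the monomial t_0^k * (PROD i. t_i^(m i)). *)

type_synonym 'n laurent = "(int \<times> ('n \<Rightarrow>\<^sub>0 nat)) \<Rightarrow>\<^sub>0 complex"

fun tvar :: "'n option \<Rightarrow> 'n laurent" where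
  "tvar None = Poly_Mapping.single (1, 0) 1"
| "tvar (Some i) = Poly_Mapping.single (0, Poly_Mapping.single i 1) 1"

definition t0_inv :: "'n laurent" where
  "t0_inv = Poly_Mapping.single (- 1, 0) 1"

(* pd j is the partial derivative by t_j.  Subtraction of exponents truncates, but only where
   the coefficient vanishes. *)

fun pd :: "'n option \<Rightarrow> 'n laurent \<Rightarrow> 'n laurent" where
  "pd None p = (\<Sum>(k, m)\<in>Poly_Mapping.keys p.
     Poly_Mapping.single (k - 1, m) (of_int k * Poly_Mapping.lookup p (k, m)))"
| "pd (Some i) p = (\<Sum>(k, m)\<in>Poly_Mapping.keys p.
     Poly_Mapping.single (k, m - Poly_Mapping.single i 1) (of_nat (Poly_Mapping.lookup m i) * Poly_Mapping.lookup p (k, m)))"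

(* The unital subalgebra of linear endomorphisms of the Laurent polynomials generated by
   the multiplications t_i / t_0 and the operators t_0 d_j.  All generators are differential
   operators, so this is the subalgebra they generate in the algebra of differential operators. *)

inductive_set dprime_ops :: "('n laurent \<Rightarrow> 'n laurent) set" where
  dp_quot: "(\<lambda>p. tvar (Some i) * t0_inv * p) \<in> dprime_ops"
| dp_der: "(\<lambda>p. tvar None * pd j p) \<in> dprime_ops"
| dp_one: "(\<lambda>p. p) \<in> dprime_ops"
| dp_add: "F \<in> dprime_ops \<Longrightarrow> G \<in> dprime_ops \<Longrightarrow> (\<lambda>p. F p + G p) \<in> dprime_ops"
| dp_scale: "F \<in> dprime_ops \<Longrightarrow> (\<lambda>p. Poly_Mapping.single 0 c * F p) \<in> dprime_ops"
| dp_comp: "F \<in> dprime_ops \<Longrightarrow> G \<in> dprime_ops \<Longrightarrow> (\<lambda>p. F (G p)) \<in> dprime_ops"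

lemma dp_uminus: "F \<in> dprime_ops \<Longrightarrow> (\<lambda>p. - F p) \<in> dprime_ops"
  using dp_scale[of F "- 1"] by (simp add: single_uminus)

lemma dp_zero: "(\<lambda>p. 0) \<in> dprime_ops"
  using dp_scale[OF dp_one, of 0] by simp

lemma pd_superset:
  assumes "finite S" "Poly_Mapping.keys p \<subseteq> S"
  shows "pd None p = (\<Sum>(k, m)\<in>S.
      Poly_Mapping.single (k - 1, m) (of_int k * Poly_Mapping.lookup p (k, m)))"
    and "pd (Some i) p = (\<Sum>(k, m)\<in>S.
      Poly_Mapping.single (k, m - Poly_Mapping.single i 1)
        (of_nat (Poly_Mapping.lookup m i) * Poly_Mapping.lookup p (k, m)))"
  unfolding pd.simps using assms
  by (intro sum.mono_neutral_left; auto simp: in_keys_iff)+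

lemma pd_add: "pd j (p + q) = pd j p + pd j q"
proof -
  define S where "S = Poly_Mapping.keys p \<union> Poly_Mapping.keys q"
  have S: "finite S" "Poly_Mapping.keys p \<subseteq> S" "Poly_Mapping.keys q \<subseteq> S"
    "Poly_Mapping.keys (p + q) \<subseteq> S"
    using Poly_Mapping.keys_add[of p q] by (auto simp: S_def)
  show ?thesis
  proof (cases j)
    case None
    show ?thesis
      unfolding None pd_superset(1)[OF S(1,2)] pd_superset(1)[OF S(1,3)]
        pd_superset(1)[OF S(1,4)] sum.distrib[symmetric]
      by (rule sum.cong) (auto simp: lookup_add distrib_left single_add)
  next
    case (Some i)
    show ?thesis
      unfolding Some pd_superset(2)[OF S(1,2)] pd_superset(2)[OF S(1,3)]
        pd_superset(2)[OF S(1,4)] sum.distrib[symmetric]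
      by (rule sum.cong) (auto simp: lookup_add distrib_left single_add)
  qed
qed

lemma lookup_scale:
  fixes p :: "'m::monoid_add \<Rightarrow>\<^sub>0 complex"
  shows "Poly_Mapping.lookup (Poly_Mapping.single 0 c * p) x = c * Poly_Mapping.lookup p x"
  unfolding mult_map_scale_conv_mult[symmetric] by (simp add: map.rep_eq when_def)

lemma pd_scale: "pd j (Poly_Mapping.single 0 c * p) = Poly_Mapping.single 0 c * pd j p"
proof -
  have S: "finite (Poly_Mapping.keys p)" "Poly_Mapping.keys p \<subseteq> Poly_Mapping.keys p"
    "Poly_Mapping.keys (Poly_Mapping.single 0 c * p) \<subseteq> Poly_Mapping.keys p"
    by (auto simp: in_keys_iff lookup_scale)
  show ?thesis
  proof (cases j)
    case None
    show ?thesis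
      unfolding None pd_superset(1)[OF S(1,2)] pd_superset(1)[OF S(1,3)] sum_distrib_left
      by (rule sum.cong) (auto simp: lookup_scale mult_single mult.left_commute)
  next
    case (Some i)
    show ?thesis
      unfolding Some pd_superset(2)[OF S(1,2)] pd_superset(2)[OF S(1,3)] sum_distrib_left
      by (rule sum.cong) (auto simp: lookup_scale mult_single mult.left_commute)
  qed
qed

lemma dprime_ops_linear:
  assumes "F \<in> dprime_ops"
  shows "F (p + q) = F p + F q"
    and "F (Poly_Mapping.single 0 c * p) = Poly_Mapping.single 0 c * F p"
proof -
  from assms have "(\<forall>p q. F (p + q) = F p + F q) \<and>
      (\<forall>c p. F (Poly_Mapping.single 0 c * p) = Poly_Mapping.single 0 c * F p)"
    by (induction rule: dprime_ops.induct)
      (auto simp: pd_add pd_scale distrib_left mult.left_commute add_ac)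
  then show "F (p + q) = F p + F q"
    and "F (Poly_Mapping.single 0 c * p) = Poly_Mapping.single 0 c * F p"
    by blast+
qed

typedef 'n dprime = "dprime_ops :: ('n laurent \<Rightarrow> 'n laurent) set"
  using dp_one by blast

setup_lifting type_definition_dprime

instantiation dprime :: (type) complex_algebra_1
begin

lift_definition zero_dprime :: "'a dprime" is "\<lambda>p. 0"
  by (rule dp_zero)
lift_definition one_dprime :: "'a dprime" is "\<lambda>p. p"
  by (rule dp_one)
lift_definition plus_dprime :: "'a dprime \<Rightarrow> 'a dprime \<Rightarrow> 'a dprime" is "\<lambda>F G p. F p + G p"
  by (rule dp_add)
lift_definition uminus_dprime :: "'a dprime \<Rightarrow> 'a dprime" is "\<lambda>F p. - F p"
  by (rule dp_uminus)
lift_definition minus_dprime :: "'a dprime \<Rightarrow> 'a dprime \<Rightarrow> 'a dprime" is "\<lambda>F G p. F p - G p"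
  using dp_add dp_uminus by fastforce
lift_definition times_dprime :: "'a dprime \<Rightarrow> 'a dprime \<Rightarrow> 'a dprime" is "\<lambda>F G p. F (G p)"
  by (rule dp_comp)
lift_definition scaleC_dprime :: "complex \<Rightarrow> 'a dprime \<Rightarrow> 'a dprime"
  is "\<lambda>c F p. Poly_Mapping.single 0 c * F p"
  by (rule dp_scale)

instance
proof
  fix x y z :: "'a dprime" and c d :: complex
  show "x + y + z = x + (y + z)" by transfer (simp add: algebra_simps)
  show "x + y = y + x" by transfer (simp add: algebra_simps)
  show "0 + x = x" by transfer simp
  show "- x + x = 0" by transfer simp
  show "x - y = x + - y" by transfer simp
  show "x * y * z = x * (y * z)" by transfer simp
  show "1 * x = x" by transfer simp
  show "x * 1 = x" by transfer simp
  show "(x + y) * z = x * z + y * z" by transfer simp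
  show "x * (y + z) = x * y + x * z" by transfer (simp add: dprime_ops_linear)
  show "(0::'a dprime) \<noteq> 1" by transfer (metis zero_neq_one)
  show "c *\<^sub>C (x + y) = c *\<^sub>C x + c *\<^sub>C y" by transfer (simp add: algebra_simps)
  show "(c + d) *\<^sub>C x = c *\<^sub>C x + d *\<^sub>C x" by transfer (simp add: algebra_simps single_add)
  show "c *\<^sub>C d *\<^sub>C x = (c * d) *\<^sub>C x"
    by transfer (simp add: mult.assoc[symmetric] mult_single)
  show "1 *\<^sub>C x = x" by transfer simp
  show "(c *\<^sub>C x) * y = c *\<^sub>C (x * y)" by transfer simp
  show "x * (c *\<^sub>C y) = c *\<^sub>C (x * y)" by transfer (simp add: dprime_ops_linear)
qed

end

lift_definition t_over_t0 :: "'n \<Rightarrow> 'n dprime" is "\<lambda>i p. tvar (Some i) * t0_inv * p"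
  by (rule dp_quot)

lift_definition t_pd :: "'n option \<Rightarrow> 'n option \<Rightarrow> 'n dprime" is "\<lambda>a b p. tvar a * pd b p"
proof -
  fix a b :: "'n option"
  show "(\<lambda>p. tvar a * pd b p) \<in> dprime_ops"
  proof (cases a)
    case None
    then show ?thesis by (simp only: dp_der)
  next
    case (Some i)
    have "t0_inv * tvar None = (1 :: 'n laurent)"
      by (simp add: t0_inv_def mult_single flip: zero_prod_def)
    then have "tvar (Some i) * t0_inv * (tvar None * pd b p) = tvar (Some i) * pd b p"
      for p :: "'n laurent"
      by (metis mult.assoc mult.left_neutral)
    with dp_comp[OF dp_quot dp_der, of i b] Some show ?thesis
      by simp
  qed
qed

definition euler :: "'n::finite dprime" where
  "euler = (\<Sum>a\<in>UNIV. t_pd a a)"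


section \<open>Tensor products of algebras\<close>

(* Pure tensors form a monoid under multiplication, written additively so that the convolution
   product of Poly_Mapping turns the free vector space on A x B into an algebra with
   (a,b)(a',b') = (aa',bb'); A \<otimes> B is its quotient by the span of the bilinearity relations. *)

datatype ('a, 'b) tpair = TPair (tfst: 'a) (tsnd: 'b)

instantiation tpair :: (monoid_mult, monoid_mult) monoid_add
begin

definition zero_tpair :: "('a, 'b) tpair" where
  "0 = TPair 1 1"

definition plus_tpair :: "('a, 'b) tpair \<Rightarrow> ('a, 'b) tpair \<Rightarrow> ('a, 'b) tpair" where
  "v + w = TPair (tfst v * tfst w) (tsnd v * tsnd w)"

instance
  by standard (simp_all add: zero_tpair_def plus_tpair_def mult.assoc)

end

inductive_set tensor_null ::
  "(('a::complex_algebra_1, 'b::complex_algebra_1) tpair \<Rightarrow>\<^sub>0 complex) set" where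
  tn_add_left: "Poly_Mapping.single (TPair (a + a') b) 1
      - (Poly_Mapping.single (TPair a b) 1 + Poly_Mapping.single (TPair a' b) 1) \<in> tensor_null"
| tn_add_right: "Poly_Mapping.single (TPair a (b + b')) 1
      - (Poly_Mapping.single (TPair a b) 1 + Poly_Mapping.single (TPair a b') 1) \<in> tensor_null"
| tn_scale_left: "Poly_Mapping.single (TPair (c *\<^sub>C a) b) 1
      - Poly_Mapping.single (TPair a b) c \<in> tensor_null"
| tn_scale_right: "Poly_Mapping.single (TPair a (c *\<^sub>C b)) 1
      - Poly_Mapping.single (TPair a b) c \<in> tensor_null"
| tn_zero: "0 \<in> tensor_null"
| tn_add: "x \<in> tensor_null \<Longrightarrow> y \<in> tensor_null \<Longrightarrow> x + y \<in> tensor_null"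
| tn_scale: "x \<in> tensor_null \<Longrightarrow> Poly_Mapping.single 0 c * x \<in> tensor_null"

lemma tn_uminus: "x \<in> tensor_null \<Longrightarrow> - x \<in> tensor_null"
  using tn_scale[of x "- 1"] by (simp add: single_uminus)

lemma tn_lmult_single: "x \<in> tensor_null \<Longrightarrow> Poly_Mapping.single k 1 * x \<in> tensor_null"
proof (induction rule: tensor_null.induct)
  case (tn_scale x c)
  have "Poly_Mapping.single k 1 * (Poly_Mapping.single 0 c * x) =
      Poly_Mapping.single 0 c * (Poly_Mapping.single k 1 * x)"
    by (metis mult.assoc single_0_central)
  with tn_scale show ?case by (simp add: tensor_null.tn_scale)
qed (cases k;
    simp add: right_diff_distrib distrib_left mult_single plus_tpair_def mult_scaleC_right
      tensor_null.intros)+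

lemma tn_rmult_single: "x \<in> tensor_null \<Longrightarrow> x * Poly_Mapping.single k 1 \<in> tensor_null"
proof (induction rule: tensor_null.induct)
  case (tn_scale x c)
  then show ?case by (simp add: tensor_null.tn_scale mult.assoc)
qed (cases k;
    simp add: left_diff_distrib distrib_right mult_single plus_tpair_def mult_scaleC_left
      tensor_null.intros)+

lemma poly_mapping_single_induct [case_names zero single add]:
  fixes p :: "'m::monoid_add \<Rightarrow>\<^sub>0 complex"
  assumes "P 0" and "\<And>k c. P (Poly_Mapping.single 0 c * Poly_Mapping.single k 1)"
    and "\<And>p q. P p \<Longrightarrow> P q \<Longrightarrow> P (p + q)"
  shows "P p"
proof (induction p rule: update_induct)
  case const
  then show ?case by (simp add: assms)
next
  case (update f a b)
  have "Poly_Mapping.update a b f = f + Poly_Mapping.single 0 b * Poly_Mapping.single a 1"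
    using update by (intro poly_mapping_eqI)
      (auto simp: mult_single lookup_update lookup_add lookup_single when_def in_keys_iff)
  with update assms show ?case by simp
qed

lemma tn_lmult: "x \<in> tensor_null \<Longrightarrow> r * x \<in> tensor_null"
  by (induction r rule: poly_mapping_single_induct)
    (simp_all add: tn_zero tn_add tn_scale tn_lmult_single distrib_right mult.assoc)

lemma tn_rmult:
  assumes "x \<in> tensor_null" shows "x * r \<in> tensor_null"
proof (induction r rule: poly_mapping_single_induct)
  case (single k c)
  have "x * (Poly_Mapping.single 0 c * Poly_Mapping.single k 1) =
      Poly_Mapping.single 0 c * (x * Poly_Mapping.single k 1)"
    by (metis mult.assoc single_0_central)
  with assms show ?case by (simp add: tn_scale tn_rmult_single)
qed (simp_all add: tn_zero tn_add distrib_left)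

lemma ex_functional:
  "\<exists>f :: 'a::complex_algebra_1 \<Rightarrow> complex.
    f 1 = 1 \<and> (\<forall>x y. f (x + y) = f x + f y) \<and> (\<forall>c x. f (c *\<^sub>C x) = c * f x)"
proof -
  interpret vector_space_pair "scaleC :: complex \<Rightarrow> 'a \<Rightarrow> 'a" "(*) :: complex \<Rightarrow> complex \<Rightarrow> complex"
    by unfold_locales
      (simp_all add: scaleC_add_right scaleC_add_left scaleC_scaleC scaleC_one algebra_simps)
  have "vs1.independent {1 :: 'a}"
    by (simp add: vs1.dependent_single)
  from linear_independent_extend[OF this, of "\<lambda>_. 1"] obtain f where
    f: "Vector_Spaces.linear scaleC (*) f" "f (1::'a) = (1::complex)" by auto
  interpret f: Vector_Spaces.linear "scaleC :: complex \<Rightarrow> 'a \<Rightarrow> 'a" "(*)" f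
    by (rule f(1))
  show ?thesis
    by (intro exI[of _ f]) (simp add: f(2) f.add f.scale)
qed

lemma one_notin_tensor_null:
  "(1 :: ('a::complex_algebra_1, 'b::complex_algebra_1) tpair \<Rightarrow>\<^sub>0 complex) \<notin> tensor_null"
proof
  obtain f :: "'a \<Rightarrow> complex" where f: "f 1 = 1" "\<And>x y. f (x + y) = f x + f y"
    "\<And>c x. f (c *\<^sub>C x) = c * f x" using ex_functional by blast
  obtain g :: "'b \<Rightarrow> complex" where g: "g 1 = 1" "\<And>x y. g (x + y) = g x + g y"
    "\<And>c x. g (c *\<^sub>C x) = c * g x" using ex_functional by blast
  define h where "h p = (\<Sum>k\<in>Poly_Mapping.keys p.
    Poly_Mapping.lookup p k * (f (tfst k) * g (tsnd k)))" for p
  have h_add: "h (p + q) = h p + h q" for p q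
    unfolding h_def by (rule setsum_keys_plus_distrib) (simp_all add: algebra_simps)
  have h_zero: "h 0 = 0" by (simp add: h_def)
  have h_diff: "h (p - q) = h p - h q" for p q
    using h_add[of "p - q" q] by simp
  have h_single: "h (Poly_Mapping.single (TPair a b) c) = c * (f a * g b)" for a b c
    by (simp add: h_def)
  have h_scale: "h (Poly_Mapping.single 0 c * p) = c * h p" for c p
  proof (induction p rule: poly_mapping_single_induct)
    case (single k d)
    then show ?case by (cases k) (simp add: mult_single h_single)
  qed (simp_all add: h_zero h_add distrib_left)
  have "x \<in> tensor_null \<Longrightarrow> h x = 0" for x
    by (induction rule: tensor_null.induct)
      (simp_all add: h_diff h_single h_add h_scale h_zero f g algebra_simps)
  moreover have "h 1 = 1"
    using h_single[of 1 1 1] by (simp add: f g flip: zero_tpair_def)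
  moreover assume "(1 :: ('a, 'b) tpair \<Rightarrow>\<^sub>0 complex) \<in> tensor_null"
  ultimately show False by force
qed

quotient_type (overloaded) ('a, 'b) tensor =
    "('a::complex_algebra_1, 'b::complex_algebra_1) tpair \<Rightarrow>\<^sub>0 complex"
  / "\<lambda>p q. p - q \<in> tensor_null"
proof (rule equivpI)
  show "reflp (\<lambda>p q. p - q \<in> (tensor_null :: (('a, 'b) tpair \<Rightarrow>\<^sub>0 complex) set))"
    by (rule reflpI) (simp add: tn_zero)
  show "symp (\<lambda>p q. p - q \<in> (tensor_null :: (('a, 'b) tpair \<Rightarrow>\<^sub>0 complex) set))"
    by (rule sympI) (metis tn_uminus minus_diff_eq)
  show "transp (\<lambda>p q. p - q \<in> (tensor_null :: (('a, 'b) tpair \<Rightarrow>\<^sub>0 complex) set))"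
  proof (rule transpI)
    fix p q r :: "('a, 'b) tpair \<Rightarrow>\<^sub>0 complex"
    assume "p - q \<in> tensor_null" "q - r \<in> tensor_null"
    from tn_add[OF this] show "p - r \<in> tensor_null" by simp
  qed
qed

instantiation tensor :: (complex_algebra_1, complex_algebra_1) complex_algebra_1
begin

lift_definition zero_tensor :: "('a, 'b) tensor" is 0 .
lift_definition one_tensor :: "('a, 'b) tensor" is 1 .

lift_definition plus_tensor :: "('a, 'b) tensor \<Rightarrow> ('a, 'b) tensor \<Rightarrow> ('a, 'b) tensor" is "(+)"
  by (metis add_diff_add tn_add)

lift_definition uminus_tensor :: "('a, 'b) tensor \<Rightarrow> ('a, 'b) tensor" is "uminus"
  by (metis tn_uminus minus_diff_minus)

lift_definition minus_tensor :: "('a, 'b) tensor \<Rightarrow> ('a, 'b) tensor \<Rightarrow> ('a, 'b) tensor" is "(-)"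
proof -
  fix p q r s :: "('a, 'b) tpair \<Rightarrow>\<^sub>0 complex"
  assume "p - q \<in> tensor_null" "r - s \<in> tensor_null"
  then have "(p - q) + - (r - s) \<in> tensor_null"
    by (intro tn_add tn_uminus)
  then show "p - r - (q - s) \<in> tensor_null"
    by (simp add: algebra_simps)
qed

lift_definition times_tensor :: "('a, 'b) tensor \<Rightarrow> ('a, 'b) tensor \<Rightarrow> ('a, 'b) tensor" is "(*)"
proof -
  fix p q r s :: "('a, 'b) tpair \<Rightarrow>\<^sub>0 complex"
  assume "p - q \<in> tensor_null" "r - s \<in> tensor_null"
  then have "(p - q) * r + q * (r - s) \<in> tensor_null"
    by (intro tn_add tn_lmult tn_rmult)
  then show "p * r - q * s \<in> tensor_null"
    by (simp add: algebra_simps)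
qed

lift_definition scaleC_tensor :: "complex \<Rightarrow> ('a, 'b) tensor \<Rightarrow> ('a, 'b) tensor"
  is "\<lambda>c p. Poly_Mapping.single 0 c * p"
  by (metis tn_lmult right_diff_distrib)

instance
proof
  fix x y z :: "('a, 'b) tensor" and c d :: complex
  show "x + y + z = x + (y + z)" by transfer (simp add: algebra_simps tn_zero)
  show "x + y = y + x" by transfer (simp add: algebra_simps tn_zero)
  show "0 + x = x" by transfer (simp add: tn_zero)
  show "- x + x = 0" by transfer (simp add: tn_zero)
  show "x - y = x + - y" by transfer (simp add: tn_zero)
  show "x * y * z = x * (y * z)" by transfer (simp add: mult.assoc tn_zero)
  show "1 * x = x" by transfer (simp add: tn_zero)
  show "x * 1 = x" by transfer (simp add: tn_zero)
  show "(x + y) * z = x * z + y * z" by transfer (simp add: algebra_simps tn_zero)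
  show "x * (y + z) = x * y + x * z" by transfer (simp add: algebra_simps tn_zero)
  show "(0::('a, 'b) tensor) \<noteq> 1"
    by transfer (auto simp: one_notin_tensor_null dest: tn_uminus)
  show "c *\<^sub>C (x + y) = c *\<^sub>C x + c *\<^sub>C y" by transfer (simp add: algebra_simps tn_zero)
  show "(c + d) *\<^sub>C x = c *\<^sub>C x + d *\<^sub>C x"
    by transfer (simp add: algebra_simps single_add tn_zero)
  show "c *\<^sub>C d *\<^sub>C x = (c * d) *\<^sub>C x"
    by transfer (simp add: mult.assoc[symmetric] mult_single tn_zero)
  show "1 *\<^sub>C x = x" by transfer (simp add: tn_zero)
  show "(c *\<^sub>C x) * y = c *\<^sub>C (x * y)" by transfer (simp add: mult.assoc tn_zero)
  show "x * (c *\<^sub>C y) = c *\<^sub>C (x * y)"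
    by transfer (metis single_0_central mult.assoc diff_self tn_zero)
qed

end

lift_definition tens ::
  "'a::complex_algebra_1 \<Rightarrow> 'b::complex_algebra_1 \<Rightarrow> ('a, 'b) tensor"  (infixl \<open>\<otimes>\<close> 75)
  is "\<lambda>a b. Poly_Mapping.single (TPair a b) 1" .


section \<open>The homomorphism rho\<close>

type_synonym 'n target = "('n dprime, 'n ugl) tensor"

definition R1 :: "'n::finite target" where
  "R1 = (- 1 / (of_nat CARD('n) + 1)) *\<^sub>C (euler \<otimes> 1 + 1 \<otimes> (\<Sum>i\<in>UNIV. E i i))"

fun rho_gen :: "'n::finite option \<Rightarrow> 'n option \<Rightarrow> 'n target" where
  "rho_gen (Some a) (Some b) =
     t_pd (Some a) (Some b) \<otimes> 1 + 1 \<otimes> E a b + (if a = b then R1 else 0)"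
| "rho_gen (Some a) None = t_pd (Some a) None \<otimes> 1 - (\<Sum>i\<in>UNIV. t_over_t0 i \<otimes> E a i)"
| "rho_gen None (Some b) = t_pd None (Some b) \<otimes> 1"
| "rho_gen None None = t_pd None None \<otimes> 1 + R1"

(* The description is proper: see rho_hom below. *)

definition rho :: "'n::finite option ugl \<Rightarrow> 'n target" where
  "rho = (THE h. alg_hom h \<and> (\<forall>a b. h (E a b) = rho_gen a b))"


subsection \<open>Existence and uniqueness of rho\<close>

lemma pd_single [simp]:
  "pd None (Poly_Mapping.single (k, m) c) = Poly_Mapping.single (k - 1, m) (of_int k * c)"
  "pd (Some i) (Poly_Mapping.single (k, m) c) =
    Poly_Mapping.single (k, m - Poly_Mapping.single i 1) (of_nat (Poly_Mapping.lookup m i) * c)"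
  by simp_all

declare pd.simps [simp del]

lemma pd_zero [simp]: "pd j 0 = 0"
  using pd_add[of j 0 0] by simp

lemma single_shift:
  "Poly_Mapping.single (k, m + m' - Poly_Mapping.single i 1)
      (of_nat (Poly_Mapping.lookup m' i) * c :: complex) =
    Poly_Mapping.single (k, m + (m' - Poly_Mapping.single i (1::nat)))
      (of_nat (Poly_Mapping.lookup m' i) * c)"
proof (cases "Poly_Mapping.lookup m' i = 0")
  case False
  then have "m + m' - Poly_Mapping.single i 1 = m + (m' - Poly_Mapping.single i 1)"
    by (intro poly_mapping_eqI) (auto simp: lookup_add lookup_minus lookup_single when_def)
  then show ?thesis by simp
qed simp

lemma pd_mult: "pd j (p * q) = pd j p * q + p * pd j q"
proof (induction p rule: poly_mapping_single_induct)
  case (single v c)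
  show ?case
  proof (induction q rule: poly_mapping_single_induct)
    case (single w d)
    obtain k m k' m' where vw: "v = (k, m)" "w = (k', m')" by (cases v; cases w)
    show ?case
    proof (cases j)
      case None
      then show ?thesis
        by (simp add: vw mult_single algebra_simps flip: single_add)
    next
      case (Some i)
      have "Poly_Mapping.single (k + k', m + m' - Poly_Mapping.single i 1)
            (of_nat (Poly_Mapping.lookup m i) * (c * d)) =
          Poly_Mapping.single (k + k', (m - Poly_Mapping.single i 1) + m')
            (of_nat (Poly_Mapping.lookup m i) * (c * d))"
        using single_shift[of "k + k'" m' m i "c * d"] by (simp add: add.commute)
      with Some single_shift[of "k + k'" m m' i "c * d"] show ?thesis
        by (simp add: vw mult_single lookup_add distrib_right single_add mult.assoc
            mult.left_commute distrib_left[of c] del: One_nat_def)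
    qed
  qed (simp_all add: distrib_left pd_add algebra_simps)
qed (simp_all add: distrib_right pd_add algebra_simps)

lemma poly_mapping_diff_commute: "m - a - b = m - b - a" for m a b :: "'n \<Rightarrow>\<^sub>0 nat"
  by (rule poly_mapping_eqI) (simp add: lookup_minus)

lemma pd_commute: "pd a (pd b p) = pd b (pd a p)"
proof (induction p rule: poly_mapping_single_induct)
  case (single v c)
  obtain k m where v: "v = (k, m)" by (cases v)
  show ?case
    by (cases a; cases b)
      (auto simp: v mult_single mult.left_commute lookup_minus lookup_single when_def
        poly_mapping_diff_commute)
qed (simp_all add: pd_add)

lemma pd_tvar: "pd b (tvar c) = (if b = c then 1 else 0)"
  by (cases b; cases c) (auto simp: lookup_single when_def simp flip: zero_prod_def)

lemma pd_t0_inv: "pd b t0_inv = (if b = None then - (t0_inv * t0_inv) else 0)"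
  by (cases b) (auto simp: t0_inv_def mult_single single_uminus)

lemma tvar_t0_inv: "tvar None * t0_inv = (1 :: 'n laurent)"
  by (simp add: t0_inv_def mult_single flip: zero_prod_def)

definition cmt :: "'a::ring \<Rightarrow> 'a \<Rightarrow> 'a" where
  "cmt x y = x * y - y * x"

lemma t_pd_cmt:
  "cmt (t_pd a b) (t_pd c d) = (if b = c then t_pd a d else 0) - (if d = a then t_pd c b else 0)"
  unfolding cmt_def
  by transfer (auto simp: fun_eq_iff pd_mult pd_tvar distrib_left mult.left_commute pd_commute)

lift_definition t_quot :: "'n option \<Rightarrow> 'n dprime" is "\<lambda>c p. tvar c * t0_inv * p"
proof -
  fix c :: "'n option"
  show "(\<lambda>p. tvar c * t0_inv * p) \<in> dprime_ops"
  proof (cases c)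
    case None
    then show ?thesis unfolding None tvar_t0_inv by (simp add: dp_one)
  next
    case (Some i)
    then show ?thesis using dp_quot[of i] by simp
  qed
qed

lemma t_quot_None: "t_quot None = 1"
  by transfer (simp only: tvar_t0_inv mult_1)

lemma t_quot_Some: "t_quot (Some i) = t_over_t0 i"
  by transfer simp

lemma t_quot_commute: "t_quot a * t_quot b = t_quot b * t_quot a"
  by transfer (simp add: fun_eq_iff mult_ac)

lemma t_pd_t_quot: "cmt (t_pd a b) (t_quot c) = (if b = c then t_quot a else 0) - (if b = None then t_quot a * t_quot c else 0)"
  unfolding cmt_def
  by transfer (auto simp: fun_eq_iff pd_mult pd_tvar pd_t0_inv algebra_simps)

lemma cmt_simps:
  "cmt (x + y) z = cmt x z + cmt y z" "cmt z (x + y) = cmt z x + cmt z y"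
  "cmt (x - y) z = cmt x z - cmt y z" "cmt z (x - y) = cmt z x - cmt z y"
  "cmt (- x) z = - cmt x z" "cmt z (- x) = - cmt z x" "cmt 0 z = 0" "cmt z 0 = 0"
  by (simp_all add: cmt_def algebra_simps)

lemma cmt_sum: "cmt (sum f S) z = (\<Sum>i\<in>S. cmt (f i) z)" "cmt z (sum f S) = (\<Sum>i\<in>S. cmt z (f i))"
  by (simp_all add: cmt_def sum_distrib_left sum_distrib_right sum_subtractf)

lemma scaleC_zero: "c *\<^sub>C 0 = (0 :: 'a::complex_algebra_1)"
  using scaleC_add_right[of c "0 :: 'a" 0] by simp

lemma cmt_scaleC: "cmt (c *\<^sub>C x) z = c *\<^sub>C cmt x z" "cmt z (c *\<^sub>C x) = c *\<^sub>C cmt z x"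
  for x z :: "'a::complex_algebra_1"
proof -
  have m: "c *\<^sub>C (x - y) = c *\<^sub>C x - c *\<^sub>C y" for x y :: 'a
    using scaleC_add_right[of c "x - y" y] by simp
  show "cmt (c *\<^sub>C x) z = c *\<^sub>C cmt x z" "cmt z (c *\<^sub>C x) = c *\<^sub>C cmt z x"
    by (simp_all add: cmt_def m mult_scaleC_left mult_scaleC_right)
qed

lemma cmt_commute: "cmt x y = - cmt y x"
  by (simp add: cmt_def)

lemma E_cmt: "cmt (E i j) (E k l) = (if j = k then E i l else 0) - (if l = i then E k j else 0)"
  unfolding cmt_def by transfer (rule gl_rel)

lemma tens_add: "(a + a') \<otimes> b = a \<otimes> b + a' \<otimes> b" "a \<otimes> (b + b') = a \<otimes> b + a \<otimes> b'"
  by (transfer, rule tn_add_left) (transfer, rule tn_add_right)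

lemma tens_mult: "(a \<otimes> b) * (c \<otimes> d) = (a * c) \<otimes> (b * d)"
  by transfer (simp add: mult_single plus_tpair_def tn_zero)

lemma tens_one: "1 \<otimes> 1 = 1"
  by transfer (simp add: tn_zero flip: zero_tpair_def)

lemma tens_zero: "0 \<otimes> b = 0" "a \<otimes> 0 = 0"
  using tens_add(1)[of 0 0 b] tens_add(2)[of a 0 0] by simp_all

lemma tens_diff: "(a - a') \<otimes> b = a \<otimes> b - a' \<otimes> b" "a \<otimes> (b - b') = a \<otimes> b - a \<otimes> b'"
  by (simp_all add: eq_diff_eq flip: tens_add)

lemma tens_uminus: "(- a) \<otimes> b = - (a \<otimes> b)" "a \<otimes> (- b) = - (a \<otimes> b)"
  using tens_diff(1)[of 0 a b] tens_diff(2)[of a 0 b] by (simp_all add: tens_zero)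

lemma tens_sum: "sum f S \<otimes> b = (\<Sum>i\<in>S. f i \<otimes> b)" "a \<otimes> sum g S = (\<Sum>i\<in>S. a \<otimes> g i)"
  by (induction S rule: infinite_finite_induct) (simp_all add: tens_add tens_zero)

lemma cmt_tens1: "cmt (a \<otimes> 1) (c \<otimes> d) = cmt a c \<otimes> d" "cmt (c \<otimes> d) (a \<otimes> 1) = cmt c a \<otimes> d"
  by (simp_all add: cmt_def tens_mult tens_diff)

lemma cmt_tens2: "cmt (1 \<otimes> b) (c \<otimes> d) = c \<otimes> cmt b d" "cmt (c \<otimes> d) (1 \<otimes> b) = c \<otimes> cmt d b"
  by (simp_all add: cmt_def tens_mult tens_diff)

lemma sum_delta_diff:
  fixes f g :: "'i::finite \<Rightarrow> 'b::ab_group_add"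
  shows "(\<Sum>a\<in>UNIV. (if a = c then f a else 0) - (if a = d then g a else 0)) = f c - g d"
    "(\<Sum>a\<in>UNIV. (if a = c then f a else 0) - (if d = a then g a else 0)) = f c - g d"
  by (simp_all add: sum_subtractf)

lemma euler_t_pd: "cmt euler (t_pd a b) = 0"
  unfolding euler_def cmt_sum t_pd_cmt sum_delta_diff by simp

lemma euler_t_quot: "cmt euler (t_quot c) = 0"
  unfolding euler_def cmt_sum t_pd_t_quot sum_delta_diff by (simp add: t_quot_None)

lemma G_E: "cmt (\<Sum>i\<in>UNIV. E i i) (E a b) = 0" for a :: "'n::finite"
  unfolding cmt_sum E_cmt sum_delta_diff by simp

lemma R1_tens:
  assumes "cmt euler a = 0" "cmt (\<Sum>i\<in>UNIV. E i i) b = 0"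
  shows "cmt R1 (a \<otimes> b) = 0"
proof -
  show ?thesis
    by (simp add: R1_def cmt_scaleC cmt_simps cmt_tens1 cmt_tens2 assms tens_zero scaleC_zero)
qed

(* rho_gen without the R1 contribution *)
fun rho_core :: "'n::finite option \<Rightarrow> 'n option \<Rightarrow> 'n target" where
  "rho_core (Some a) (Some b) = 1 \<otimes> E a b"
| "rho_core (Some a) None = - (\<Sum>i\<in>UNIV. t_over_t0 i \<otimes> E a i)"
| "rho_core None _ = 0"

lemma rho_gen_core: "rho_gen a b = t_pd a b \<otimes> 1 + rho_core a b + (if a = b then R1 else 0)"
  by (cases a; cases b) simp_all

lemma cmt_one: "cmt 1 x = 0" "cmt x 1 = 0" for x :: "'a::ring_1"
  by (simp_all add: cmt_def)

lemma R1_central: "cmt R1 (t_pd a b \<otimes> 1) = 0" "cmt R1 (rho_core a b) = 0"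
proof -
  show "cmt R1 (t_pd a b \<otimes> 1) = 0"
    by (rule R1_tens) (simp_all add: euler_t_pd cmt_one)
  have "cmt R1 (1 \<otimes> E i j) = 0" for i j :: 'a
    by (rule R1_tens) (simp_all add: G_E cmt_one)
  moreover have "cmt R1 (t_over_t0 k \<otimes> E i j) = 0" for i j k :: 'a
    unfolding t_quot_Some[symmetric] by (rule R1_tens) (simp_all add: G_E euler_t_quot)
  ultimately show "cmt R1 (rho_core a b) = 0"
    by (cases a; cases b) (simp_all add: cmt_simps cmt_sum)
qed

lemma cmt_t_pd_core_None:
  "cmt (t_pd a None \<otimes> 1) (rho_core (Some c) None) = (\<Sum>i\<in>UNIV. (t_quot a * t_quot (Some i)) \<otimes> E c i)"
  "cmt (t_pd a (Some b) \<otimes> 1) (rho_core (Some c) None) = - (t_quot a \<otimes> E c b)"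
proof -
  show "cmt (t_pd a None \<otimes> 1) (rho_core (Some c) None) = (\<Sum>i\<in>UNIV. (t_quot a * t_quot (Some i)) \<otimes> E c i)"
    by (simp add: cmt_simps cmt_sum cmt_tens1 t_pd_t_quot tens_uminus sum_negf flip: t_quot_Some)
  have "(if Some b = Some i then t_quot a else 0) \<otimes> E c i = (if b = i then t_quot a \<otimes> E c i else 0)" for i
    by (simp add: tens_zero)
  then show "cmt (t_pd a (Some b) \<otimes> 1) (rho_core (Some c) None) = - (t_quot a \<otimes> E c b)"
    by (simp add: cmt_simps cmt_sum cmt_tens1 t_pd_t_quot flip: t_quot_Some)
qed

lemma cmt_t_pd_core_Some: "cmt (t_pd a b \<otimes> 1) (rho_core (Some c) (Some d)) = 0"
  by (simp add: cmt_tens1 cmt_one tens_zero)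

lemma cmt_E_core_None:
  "cmt (rho_core (Some a) (Some b)) (rho_core (Some c) None) =
    (if b = c then rho_core (Some a) None else 0) + t_quot (Some a) \<otimes> E c b"
proof -
  have "cmt (rho_core (Some a) (Some b)) (rho_core (Some c) None) =
      - (\<Sum>i\<in>UNIV. t_quot (Some i) \<otimes> ((if b = c then E a i else 0) - (if i = a then E c b else 0)))"
    by (simp add: cmt_simps cmt_sum cmt_tens2 E_cmt flip: t_quot_Some)
  also have "\<dots> = - (\<Sum>i\<in>UNIV. (if b = c then t_quot (Some i) \<otimes> E a i else 0)
      - (if i = a then t_quot (Some i) \<otimes> E c b else 0))"
    by (intro arg_cong[of _ _ uminus] sum.cong) (auto simp: tens_diff tens_zero)
  also have "\<dots> = (if b = c then rho_core (Some a) None else 0) + t_quot (Some a) \<otimes> E c b"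
    by (simp add: sum_subtractf flip: t_quot_Some)
  finally show ?thesis .
qed

lemma tens_cmt_commuting:
  "a * c = c * a \<Longrightarrow> cmt (a \<otimes> b) (c \<otimes> d) = (a * c) \<otimes> cmt b d"
  by (simp add: cmt_def tens_mult tens_diff)

lemma cmt_core_None_core_None:
  "cmt (rho_core (Some a) None) (rho_core (Some c) None) =
    (\<Sum>i\<in>UNIV. (t_quot (Some c) * t_quot (Some i)) \<otimes> E a i) - (\<Sum>i\<in>UNIV. (t_quot (Some a) * t_quot (Some i)) \<otimes> E c i)"
proof -
  have "cmt (rho_core (Some a) None) (rho_core (Some c) None) =
      (\<Sum>i\<in>UNIV. \<Sum>j\<in>UNIV. (t_quot (Some j) * t_quot (Some i)) \<otimes> cmt (E a j) (E c i))"
    by (simp add: cmt_simps cmt_sum tens_cmt_commuting[OF t_quot_commute] sum_negf flip: t_quot_Some)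
  also have "\<dots> = (\<Sum>i\<in>UNIV. \<Sum>j\<in>UNIV. (if j = c then (t_quot (Some j) * t_quot (Some i)) \<otimes> E a i else 0)
      - (if i = a then (t_quot (Some j) * t_quot (Some i)) \<otimes> E c j else 0))"
    by (intro sum.cong) (auto simp: E_cmt tens_diff tens_zero)
  also have "\<dots> = (\<Sum>i\<in>UNIV. (t_quot (Some c) * t_quot (Some i)) \<otimes> E a i) -
      (\<Sum>j\<in>UNIV. \<Sum>i\<in>UNIV. if i = a then (t_quot (Some j) * t_quot (Some i)) \<otimes> E c j else 0)"
  proof -
    have "(\<Sum>i\<in>UNIV. \<Sum>j\<in>UNIV. if i = a then (t_quot (Some j) * t_quot (Some i)) \<otimes> E c j else 0) =
        (\<Sum>j\<in>UNIV. \<Sum>i\<in>UNIV. if i = a then (t_quot (Some j) * t_quot (Some i)) \<otimes> E c j else 0)"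
      by (rule sum.swap)
    then show ?thesis
      by (simp only: sum_subtractf) simp
  qed
  also have "\<dots> = (\<Sum>i\<in>UNIV. (t_quot (Some c) * t_quot (Some i)) \<otimes> E a i) -
      (\<Sum>i\<in>UNIV. (t_quot (Some a) * t_quot (Some i)) \<otimes> E c i)"
    by (simp add: t_quot_commute[of _ "Some a"])
  finally show ?thesis .
qed

lemma rho_core_rel_aux:
  "cmt (t_pd a b \<otimes> 1) (rho_core (Some c) d) + cmt (rho_core a b) (t_pd (Some c) d \<otimes> 1) + cmt (rho_core a b) (rho_core (Some c) d) =
    (if b = Some c then rho_core a d else 0) - (if d = a then rho_core (Some c) b else 0)"
  if "a = None \<or> b \<noteq> None \<or> d = None"
proof (cases a)
  case None
  then show ?thesis
  proof (cases b; cases d)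
    assume "b = None" "d = None"
    with None show ?thesis
      by (simp add: cmt_t_pd_core_None cmt_simps t_quot_None del: rho_core.simps(1,2)) (simp add: t_quot_Some)
  next
    fix b' assume "b = Some b'" "d = None"
    with None show ?thesis
      by (simp add: cmt_t_pd_core_None cmt_simps t_quot_None del: rho_core.simps(1,2)) simp
  next
    fix d' assume "b = None" "d = Some d'"
    with None show ?thesis
      by (simp add: cmt_t_pd_core_Some cmt_simps del: rho_core.simps(1,2))
  next
    fix b' d' assume "b = Some b'" "d = Some d'"
    with None show ?thesis
      by (simp add: cmt_t_pd_core_Some cmt_simps del: rho_core.simps(1,2))
  qed
next
  case (Some a')
  show ?thesis
  proof (cases b)
    case b: None
    with that Some have d: "d = None" by simp
    show ?thesis
      unfolding Some b d
      by (simp add: cmt_t_pd_core_None cmt_core_None_core_None cmt_commute[of "rho_core _ _" "t_pd _ _ \<otimes> 1"]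
          del: rho_core.simps)
  next
    case b: (Some b')
    show ?thesis
    proof (cases d)
      case d: None
      show ?thesis
        unfolding Some b d
        by (simp add: cmt_t_pd_core_None cmt_t_pd_core_Some cmt_E_core_None
            cmt_commute[of "rho_core _ _" "t_pd _ _ \<otimes> 1"] del: rho_core.simps)
    next
      case d: (Some d')
      show ?thesis
        unfolding Some b d
        by (simp add: cmt_t_pd_core_Some cmt_commute[of "rho_core _ _" "t_pd _ _ \<otimes> 1"] del: rho_core.simps)
         (simp add: cmt_tens2 E_cmt tens_diff tens_uminus tens_zero)
    qed
  qed
qed

lemma rho_core_rel:
  "cmt (t_pd a b \<otimes> 1) (rho_core c d) + cmt (rho_core a b) (t_pd c d \<otimes> 1) + cmt (rho_core a b) (rho_core c d) =
    (if b = c then rho_core a d else 0) - (if d = a then rho_core c b else 0)"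
proof (cases "c \<noteq> None \<and> (a = None \<or> b \<noteq> None \<or> d = None)")
  case True
  with rho_core_rel_aux[of a b d] show ?thesis by auto
next
  case False
  show ?thesis
  proof (cases "a = None")
    case True
    with False show ?thesis by (auto simp: cmt_simps)
  next
    case a: False
    then obtain a' where a': "a = Some a'" by blast
    from False a have "c = None \<or> d \<noteq> None \<or> b = None" by auto
    from rho_core_rel_aux[OF this, of a'] show ?thesis
      unfolding a' cmt_commute[of "t_pd (Some a') b \<otimes> 1"] cmt_commute[of "rho_core (Some a') b"]
      by (simp add: algebra_simps del: rho_core.simps)
  qed
qed

lemma rho_gen_rel:
  "cmt (rho_gen a b) (rho_gen c d) = (if b = c then rho_gen a d else 0) - (if d = a then rho_gen c b else 0)"
proof -
  have R: "cmt (t_pd a b \<otimes> 1) R1 = 0" "cmt (rho_core a b) R1 = 0" for a b :: "'a option"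
    using R1_central[of a b] by (simp_all add: cmt_commute[of _ R1])
  have "cmt (rho_gen a b) (rho_gen c d) = cmt (t_pd a b \<otimes> 1) (t_pd c d \<otimes> 1) +
     (cmt (t_pd a b \<otimes> 1) (rho_core c d) + cmt (rho_core a b) (t_pd c d \<otimes> 1) + cmt (rho_core a b) (rho_core c d))"
    unfolding rho_gen_core by (simp add: cmt_simps R1_central R)
      (simp add: cmt_def)
  also have "\<dots> = (if b = c then rho_gen a d else 0) - (if d = a then rho_gen c b else 0)"
    unfolding rho_core_rel cmt_tens1 t_pd_cmt unfolding rho_gen_core
    by (auto simp: tens_diff tens_zero simp del: rho_core.simps)
  finally show ?thesis .
qed

definition feval :: "('x \<Rightarrow> 'b::complex_algebra_1) \<Rightarrow> 'x free_algebra \<Rightarrow> 'b" where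
  "feval f p = (\<Sum>w\<in>Poly_Mapping.keys p.
     Poly_Mapping.lookup p w *\<^sub>C prod_list (map f (letters w)))"

lemma scaleC_zero_left: "0 *\<^sub>C x = (0 :: 'a::complex_algebra_1)"
  using scaleC_add_left[of 0 0 x] by simp

lemma feval_add: "feval f (p + q) = feval f p + feval f q"
  unfolding feval_def
  by (rule setsum_keys_plus_distrib) (simp_all add: scaleC_zero_left scaleC_add_left)

lemma feval_zero: "feval f 0 = 0"
  by (simp add: feval_def)

lemma feval_diff: "feval f (p - q) = feval f p - feval f q"
  using feval_add[of f "p - q" q] by simp

lemma feval_single: "feval f (Poly_Mapping.single w c) = c *\<^sub>C prod_list (map f (letters w))"
  by (simp add: feval_def scaleC_zero_left)

lemma feval_mult: "feval f (p * q) = feval f p * feval f q"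
proof (induction p rule: poly_mapping_single_induct)
  case (single v c)
  show ?case
  proof (induction q rule: poly_mapping_single_induct)
    case (single w d)
    show ?case
      by (simp add: mult_single feval_single plus_fword_def mult_scaleC_left mult_scaleC_right
          scaleC_scaleC zero_fword_def mult.assoc mult.commute[of c d])
  qed (simp_all add: feval_zero feval_add distrib_left)
qed (simp_all add: feval_zero feval_add distrib_right)

lemma feval_scale: "feval f (Poly_Mapping.single 0 c * p) = c *\<^sub>C feval f p"
  by (simp add: feval_mult feval_single zero_fword_def mult_scaleC_left)

lemma feval_one: "feval f 1 = 1"
  unfolding single_one[symmetric] feval_single by (simp add: zero_fword_def scaleC_one)

lemma feval_gen: "feval f (free_gen x) = f x"
  by (simp add: free_gen_def feval_single scaleC_one)

lemma feval_if: "feval f (if P then free_gen x else 0) = (if P then f x else 0)"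
  by (simp add: feval_gen feval_zero)

lemma feval_rho_ideal: "p \<in> gl_ideal \<Longrightarrow> feval (\<lambda>(a, b). rho_gen a b) p = 0"
proof (induction rule: gl_ideal.induct)
  case (gl_rel i j k l)
  show ?case
    unfolding feval_diff feval_mult feval_gen feval_if prod.case rho_gen_rel[unfolded cmt_def]
    by (rule diff_self)
next
  case gl_zero
  show ?case by (rule feval_zero)
next
  case (gl_add x y)
  then show ?case by (simp only: feval_add add_0)
next
  case (gl_lmult x r)
  then show ?case by (simp only: feval_mult mult_zero_right)
next
  case (gl_rmult x r)
  then show ?case by (simp only: feval_mult mult_zero_left)
qed

definition rho0 :: "'n::finite option ugl \<Rightarrow> 'n target" where
  "rho0 x = feval (\<lambda>(a, b). rho_gen a b) (rep_ugl x)"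

lemma rho0_abs: "rho0 (abs_ugl p) = feval (\<lambda>(a, b). rho_gen a b) p"
proof -
  have "abs_ugl (rep_ugl (abs_ugl p)) = abs_ugl p"
    by (rule Quotient3_abs_rep[OF Quotient3_ugl])
  then have "rep_ugl (abs_ugl p) - p \<in> gl_ideal"
    by (simp only: ugl.abs_eq_iff)
  from feval_rho_ideal[OF this] show ?thesis
    unfolding rho0_def feval_diff by (simp only: right_minus_eq)
qed

lemma rho0_hom: "alg_hom rho0"
  unfolding alg_hom_def
proof (intro conjI allI)
  fix x y :: "'a option ugl" and c
  obtain p q where x: "x = abs_ugl p" and y: "y = abs_ugl q"
    by (metis Quotient3_abs_rep[OF Quotient3_ugl])
  show "rho0 1 = (1 :: 'a target)"
    unfolding one_ugl_def rho0_abs by (rule feval_one)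
  show "rho0 (x + y) = rho0 x + rho0 y"
    unfolding x y plus_ugl.abs_eq rho0_abs by (rule feval_add)
  show "rho0 (x * y) = rho0 x * rho0 y"
    unfolding x y times_ugl.abs_eq rho0_abs by (rule feval_mult)
  show "rho0 (c *\<^sub>C x) = c *\<^sub>C rho0 x"
    unfolding x scaleC_ugl.abs_eq rho0_abs by (rule feval_scale)
qed

lemma rho0_E: "rho0 (E a b) = rho_gen a b"
  unfolding E_def by (simp only: map_fun_apply id_apply rho0_abs feval_gen prod.case)

lemma ugl_hom_unique:
  fixes h h' :: "'i ugl \<Rightarrow> 'b::complex_algebra_1"
  assumes "alg_hom h" "alg_hom h'" "\<And>a b. h (E a b) = h' (E a b)"
  shows "h = h'"
proof
  fix x :: "'i ugl"
  have hom: "h (abs_ugl p) = h' (abs_ugl p)" for p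
  proof (induction p rule: poly_mapping_single_induct)
    case zero
    have "h 0 = 0" "h' 0 = 0"
      using assms(1,2) unfolding alg_hom_def by (metis add_cancel_right_right)+
    then show ?case by (simp add: zero_ugl_def)
  next
    case (add p q)
    then show ?case
      using assms(1,2) by (simp add: alg_hom_def flip: plus_ugl.abs_eq)
  next
    case (single w c)
    have "h (abs_ugl (Poly_Mapping.single (FWord xs) 1)) = h' (abs_ugl (Poly_Mapping.single (FWord xs) 1))"
      for xs
    proof (induction xs)
      case Nil
      then show ?case
        using assms(1,2) by (simp add: alg_hom_def flip: zero_fword_def one_ugl_def)
    next
      case (Cons y ys)
      have "Poly_Mapping.single (FWord (y # ys)) (1::complex) = free_gen y * Poly_Mapping.single (FWord ys) 1"
        by (simp add: free_gen_def mult_single plus_fword_def)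
      moreover have "abs_ugl (free_gen y) = E (fst y) (snd y)"
        by (simp add: E_def)
      ultimately show ?case
        using assms Cons.IH by (simp add: alg_hom_def flip: times_ugl.abs_eq)
    qed
    moreover obtain xs where "w = FWord xs" by (cases w)
    ultimately show ?case
      using assms(1,2) by (simp add: alg_hom_def flip: scaleC_ugl.abs_eq)
  qed
  show "h x = h' x"
    by (induction x rule: ugl.abs_induct) (rule hom)
qed

(* rho_gen satisfies the defining relations of U(gl(n+1)), so rho is well-defined. *)

lemma rho_hom: "alg_hom rho" "rho (E a b) = rho_gen a b"
proof -
  have "\<exists>!h. alg_hom h \<and> (\<forall>a b. h (E a b) = rho_gen a b)"
    by (rule ex1I[of _ rho0]) (auto simp: rho0_hom rho0_E intro!: ugl_hom_unique)
  from theI'[OF this, folded rho_def]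
  show "alg_hom rho" "rho (E a b) = rho_gen a b" by blast+
qed


section \<open>The Capelli determinant\<close>

definition col_det :: "('i::{finite, linorder} \<Rightarrow> 'i \<Rightarrow> 'a::ring_1) \<Rightarrow> 'a" where
  "col_det A = (\<Sum>\<sigma> | \<sigma> permutes UNIV.
     of_int (sign \<sigma>) * prod_list (map (\<lambda>j. A (\<sigma> j) j) (sorted_list_of_set UNIV)))"

(* Polynomials in T over a noncommutative ring: type poly has no multiplication there, but
   (nat =>0 'a) with the convolution product is the polynomial ring with T central. *)

definition pconst :: "'a::zero \<Rightarrow> (nat \<Rightarrow>\<^sub>0 'a)" where
  "pconst a = Poly_Mapping.single 0 a"

definition polyT :: "nat \<Rightarrow>\<^sub>0 'a::zero_neq_one" where
  "polyT = Poly_Mapping.single 1 1"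

(* The number of i in the enumeration 0, 1, 2, ... of its type. *)

definition index :: "'i::{finite, linorder} \<Rightarrow> nat" where
  "index i = card {j. j < i}"

definition capelli :: "nat \<Rightarrow>\<^sub>0 'i::{finite, linorder} ugl" where
  "capelli = col_det (\<lambda>i j. pconst (E i j) - (if i = j then polyT + of_nat (index i) else 0))"

(* Poly_Mapping.map applies rho to every coefficient, as rho 0 = 0. *)

definition C_rho :: "nat \<Rightarrow>\<^sub>0 'n::{finite, linorder} target" where
  "C_rho = Poly_Mapping.map rho (capelli :: nat \<Rightarrow>\<^sub>0 'n option ugl)"


section \<open>Matrices\<close>

(* The library's times and power on vectors are componentwise. *)

primrec mat_power :: "'a::semiring_1 ^ 'k ^ 'k \<Rightarrow> nat \<Rightarrow> 'a ^ 'k ^ 'k" where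
  "mat_power A 0 = mat 1"
| "mat_power A (Suc m) = A ** mat_power A m"

(* Coefficients act as scalar matrices on the left; those of C_rho are central. *)

definition eval_mat :: "(nat \<Rightarrow>\<^sub>0 'a::semiring_1) \<Rightarrow> 'a ^ 'k ^ 'k \<Rightarrow> 'a ^ 'k ^ 'k" where
  "eval_mat p A = (\<Sum>m\<in>Poly_Mapping.keys p. mat (Poly_Mapping.lookup p m) ** mat_power A m)"

(* E_mat $ i $ j is the entry in row i and column j. *)

definition E_mat :: "'n::finite target ^ 'n ^ 'n" where
  "E_mat = (\<chi> i j. 1 \<otimes> E i j)"

end

theory Submission
  imports Defs
begin

text \<open>
The \<open>gl(n+1)\<close>-matrix \<open>rho_gen\<close> is, apart from its first column, the matrix of \<open>1 \<otimes> E i j + \<delta>\<^sub>i\<^sub>j R1\<close>, with a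
zero row added, plus a rank one matrix whose columns are multiples of the vector \<open>x\<close> with entries
\<open>t\<^sub>a / t\<^sub>0\<close>.  The first column is a multiple of \<open>x\<close> up to a combination of the others.  Column operations
in the Capelli determinant therefore give the factorization
\<open>C_rho = (\<E> + R1 - T) C\<^sub>n(T - R1)\<close>, where \<open>C\<^sub>n\<close> is the Capelli determinant of \<open>gl(n)\<close> with
shifts starting at 1 (\<open>C_rho_factorization\<close>, from \<open>capelli_det_factor\<close>).

So both matrices need only be roots of \<open>C\<^sub>n(T - R1)\<close>.  As \<open>R1\<close> is central, that polynomial
is the Capelli determinant of the matrix \<open>1 \<otimes> E i j + \<delta>\<^sub>i\<^sub>j R1\<close>, which satisfies the relations of
\<open>gl(n)\<close>, and the claims are the two characteristic identities of \<open>gl(n)\<close>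
(\<open>characteristic_identities\<close>).  These are proved like the Cayley-Hamilton theorem.  The exchange
relation between columns of consecutive shifts makes Capelli determinants antisymmetric in the
column indices, so expansion along the last or the first column gives cofactor matrices
(\<open>capelli_left_adjugate\<close>, \<open>capelli_right_adjugate\<close>).  The first identity follows with
coefficients on the left of the powers.  For the transposed matrix the expansion yields coefficients
on the right, and they are moved to the left by centrality of the Capelli determinant
(\<open>cmt_capelli_det\<close>).
\<close>


section \<open>Column determinants of lists of columns\<close>

abbreviation inds :: "'i::{finite, linorder} list" where
  "inds \<equiv> sorted_list_of_set UNIV"

text \<open>If \<open>\<psi>\<^sub>i\<close> are anticommuting variables that commute with the ring, the product of the vectors
\<open>\<Sum>\<^sub>i \<psi>\<^sub>i v\<^sub>i\<close>, taken in the order of the list, is \<open>cdet vs\<close> times the top monomial, for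
lists of length \<open>CARD('i)\<close>.  All manipulations
of \<open>cdet\<close> below are computations in this Grassmann algebra, phrased for lists of columns because
the columns get permuted and replaced.\<close>

definition cdet :: "('i::{finite, linorder} \<Rightarrow> 'a::ring_1) list \<Rightarrow> 'a" where
  "cdet vs = (\<Sum>\<sigma> | \<sigma> permutes UNIV.
     of_int (sign \<sigma>) * prod_list (map2 (\<lambda>v j. v (\<sigma> j)) vs inds))"

lemma col_det_eq_cdet: "col_det A = cdet (map (\<lambda>j i. A i j) inds)"
  by (simp add: col_det_def cdet_def zip_map1 zip_same_conv_map o_def case_prod_beta)

text \<open>The ring may have 2-torsion, so antisymmetry alone does not suffice: the permutations are paired off
by composition with the transposition, one member of each pair being increasing on \<open>{j, k}\<close>.\<close>

lemma sum_permutations_antisym: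
  fixes f :: "('i::{finite, linorder} \<Rightarrow> 'i) \<Rightarrow> 'a::ab_group_add"
  assumes "j \<noteq> k"
    and anti: "\<And>\<sigma>. \<sigma> permutes UNIV \<Longrightarrow> f (\<sigma> \<circ> Transposition.transpose j k) = - f \<sigma>"
  shows "(\<Sum>\<sigma> | \<sigma> permutes UNIV. f \<sigma>) = 0"
proof -
  let ?\<tau> = "Transposition.transpose j k"
  define S where "S = {\<sigma> :: 'i \<Rightarrow> 'i. \<sigma> permutes UNIV \<and> \<sigma> j < \<sigma> k}"
  define R where "R = {\<sigma> :: 'i \<Rightarrow> 'i. \<sigma> permutes UNIV \<and> \<sigma> k < \<sigma> j}"
  have neq: "\<sigma> j \<noteq> \<sigma> k" if "\<sigma> permutes UNIV" for \<sigma>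
    using permutes_inj[OF that] \<open>j \<noteq> k\<close> by (auto dest: injD)
  have \<tau>: "?\<tau> permutes UNIV" by (simp add: permutes_swap_id)
  have "{\<sigma>. \<sigma> permutes UNIV} = S \<union> R"
    using neq by (auto simp: S_def R_def) (metis linorder_less_linear)
  moreover have "S \<inter> R = {}" by (auto simp: S_def R_def)
  ultimately have "(\<Sum>\<sigma> | \<sigma> permutes UNIV. f \<sigma>) = sum f S + sum f R"
    by (simp add: sum.union_disjoint)
  also have "sum f R = (\<Sum>\<sigma>\<in>S. f (\<sigma> \<circ> ?\<tau>))"
    by (rule sum.reindex_bij_witness[where i = "\<lambda>\<sigma>. \<sigma> \<circ> ?\<tau>" and j = "\<lambda>\<sigma>. \<sigma> \<circ> ?\<tau>"])
      (auto simp: S_def R_def comp_assoc intro!: permutes_compose[OF \<tau>])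
  also have "\<dots> = - sum f S"
    unfolding sum_negf[symmetric] by (rule sum.cong) (auto simp: S_def anti)
  finally show ?thesis by simp
qed

lemma inds_split_pair:
  assumes "m + 2 + l = CARD('i::{finite, linorder})"
  obtains ks j k ls where "(inds :: 'i list) = ks @ j # k # ls" "length ks = m" "length ls = l"
proof -
  have len: "length (inds :: 'i list) = m + 2 + l" using assms by simp
  have "inds = take m inds @ inds ! m # inds ! Suc m # drop (Suc (Suc m)) (inds :: 'i list)"
    using len by (simp add: Cons_nth_drop_Suc)
  then show ?thesis by (rule that) (use len in simp_all)
qed

text \<open>In the Grassmann algebra a product of two adjacent vectors depends only on the antisymmetric part
of the coefficients \<open>v a * w b\<close>.  So an identity between such products of degree two may be used
inside a determinant.\<close>

lemma cdet_symmetric_pairs: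
  fixes v w v' w' :: "'i::{finite, linorder} \<Rightarrow> 'a::ring_1"
  assumes sym: "\<And>a b. v a * w b + v' a * w' b = v b * w a + v' b * w' a"
    and len: "length pre + 2 + length post = CARD('i)"
  shows "cdet (pre @ v # w # post) + cdet (pre @ v' # w' # post) = 0"
proof -
  obtain ks j k ls where inds: "(inds :: 'i list) = ks @ j # k # ls" "length ks = length pre"
    using inds_split_pair[OF len] by metis
  have "distinct (ks @ j # k # ls)" using inds(1)[symmetric] by simp
  then have dist: "j \<noteq> k" "j \<notin> set ks" "k \<notin> set ks" "j \<notin> set ls" "k \<notin> set ls" by auto
  define P :: "('i \<Rightarrow> 'a) list \<Rightarrow> 'i list \<Rightarrow> ('i \<Rightarrow> 'i) \<Rightarrow> 'a"
    where "P us js \<sigma> = prod_list (map2 (\<lambda>u j. u (\<sigma> j)) us js)" for us js \<sigma>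
  have P: "P us js (\<sigma> \<circ> Transposition.transpose j k) = P us js \<sigma>"
    if "j \<notin> set js" "k \<notin> set js" for us js \<sigma>
    unfolding P_def using that
    by (intro arg_cong[of _ _ prod_list] map_cong) (auto dest!: set_zip_rightD simp: transpose_def)
  define f where "f = (\<lambda>\<sigma>. of_int (sign \<sigma>) * (P pre ks \<sigma> *
      (v (\<sigma> j) * w (\<sigma> k) + v' (\<sigma> j) * w' (\<sigma> k)) * P post ls \<sigma>))"
  have "cdet (pre @ v # w # post) + cdet (pre @ v' # w' # post) = (\<Sum>\<sigma> | \<sigma> permutes UNIV. f \<sigma>)"
    unfolding cdet_def inds(1) f_def P_def
    by (simp add: inds(2) algebra_simps flip: sum.distrib)
  also have "\<dots> = 0"
  proof (rule sum_permutations_antisym[OF dist(1)])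
    fix \<sigma> :: "'i \<Rightarrow> 'i" assume "\<sigma> permutes UNIV"
    then have "permutation \<sigma>" by (auto simp: permutation_permutes)
    then have "sign (\<sigma> \<circ> Transposition.transpose j k) = - sign \<sigma>"
      using dist(1) by (simp add: sign_compose permutation_swap_id sign_swap_id)
    then show "f (\<sigma> \<circ> Transposition.transpose j k) = - f \<sigma>"
      unfolding f_def by (simp add: P dist sym[of "\<sigma> k" "\<sigma> j"])
  qed
  finally show ?thesis .
qed

lemma of_int_commute_left: "x * (of_int k * y) = of_int k * (x * y)" for x y :: "'a::ring_1"
  by (metis mult.assoc mult_of_int_commute)

lemma cdet_add:
  "length pre + 1 + length post = CARD('i) \<Longrightarrow>
   cdet (pre @ (\<lambda>i. v i + w i) # post) = cdet (pre @ v # post) + cdet (pre @ w # post)"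
  for v w :: "'i::{finite, linorder} \<Rightarrow> 'a::ring_1"
proof -
  assume len: "length pre + 1 + length post = CARD('i)"
  then have len: "length (inds :: 'i list) = length pre + 1 + length post" by simp
  have inds: "(inds :: 'i list) = take (length pre) inds @ inds ! length pre # drop (Suc (length pre)) inds"
    by (rule id_take_nth_drop) (use len in simp)
  show ?thesis
    unfolding cdet_def by (subst (1 2 3) inds) (use len in \<open>simp add: algebra_simps min_def flip: sum.distrib\<close>)
qed

lemma cdet_symmetric_pair:
  fixes v w :: "'i::{finite, linorder} \<Rightarrow> 'a::ring_1"
  assumes "\<And>a b. v a * w b = v b * w a" "length pre + 2 + length post = CARD('i)"
  shows "cdet (pre @ v # w # post) = 0"
proof -
  have "cdet (pre @ (\<lambda>_. 0) # w # post) = 0"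
    using cdet_add[of pre "w # post" "\<lambda>_. 0" "\<lambda>_. 0"] assms(2) by simp
  then show ?thesis
    using cdet_symmetric_pairs[of v w "\<lambda>_. 0" w pre post] assms by simp
qed

lemma cdet_expand_first:
  "cdet (v # post) = (\<Sum>a\<in>UNIV. v a * cdet ((\<lambda>i. if i = a then 1 else 0) # post))"
  for v :: "'i::{finite, linorder} \<Rightarrow> 'a::ring_1"
proof -
  obtain j js where inds: "(inds :: 'i list) = j # js"
    by (cases "inds :: 'i list") auto
  define P where "P \<sigma> = prod_list (map2 (\<lambda>u j. u (\<sigma> j)) post js)" for \<sigma>
  have "(\<Sum>a\<in>UNIV. v a * cdet ((\<lambda>i. if i = a then 1 else 0) # post)) =
    (\<Sum>a\<in>UNIV. \<Sum>\<sigma> | \<sigma> permutes UNIV. (if a = \<sigma> j then of_int (sign \<sigma>) * (v a * P \<sigma>) else 0))"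
    by (auto simp: cdet_def inds P_def sum_distrib_left of_int_commute_left intro!: sum.cong)
  also have "\<dots> = (\<Sum>\<sigma> | \<sigma> permutes UNIV. of_int (sign \<sigma>) * (v (\<sigma> j) * P \<sigma>))"
    by (subst sum.swap) simp
  also have "\<dots> = cdet (v # post)"
    by (simp add: cdet_def inds P_def)
  finally show ?thesis by simp
qed

lemma cdet_expand_last:
  fixes v :: "'i::{finite, linorder} \<Rightarrow> 'a::ring_1"
  assumes len: "length pre + 1 = CARD('i)"
  shows "cdet (pre @ [v]) = (\<Sum>a\<in>UNIV. cdet (pre @ [\<lambda>i. if i = a then 1 else 0]) * v a)"
proof -
  obtain j js where inds: "(inds :: 'i list) = js @ [j]" and js: "length js = length pre"
    using len by (cases "inds :: 'i list" rule: rev_cases) (auto, metis add_left_cancel length_append_singleton length_sorted_list_of_set plus_1_eq_Suc nat.inject)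
  define P where "P \<sigma> = prod_list (map2 (\<lambda>u j. u (\<sigma> j)) pre js)" for \<sigma>
  have "(\<Sum>a\<in>UNIV. cdet (pre @ [\<lambda>i. if i = a then 1 else 0]) * v a) =
    (\<Sum>a\<in>UNIV. \<Sum>\<sigma> | \<sigma> permutes UNIV. (if a = \<sigma> j then of_int (sign \<sigma>) * (P \<sigma> * v a) else 0))"
    by (auto simp: cdet_def inds P_def js sum_distrib_right mult.assoc intro!: sum.cong)
  also have "\<dots> = (\<Sum>\<sigma> | \<sigma> permutes UNIV. of_int (sign \<sigma>) * (P \<sigma> * v (\<sigma> j)))"
    by (subst sum.swap) simp
  also have "\<dots> = cdet (pre @ [v])"
    by (simp add: cdet_def inds P_def js)
  finally show ?thesis by simp
qed


section \<open>Capelli determinants of matrices satisfying the relations of gl\<close>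

definition central :: "'a::ring_1 \<Rightarrow> bool" where
  "central u \<longleftrightarrow> (\<forall>x. u * x = x * u)"

lemma centralD: "central u \<Longrightarrow> u * x = x * u"
  by (simp add: central_def)

lemma central_diff_of_nat: "central u \<Longrightarrow> central (u - of_nat k)"
  by (simp add: central_def algebra_simps mult_of_nat_commute)

lemma central_diff_one: "central u \<Longrightarrow> central (u - 1)"
  using central_diff_of_nat[of u 1] by simp

text \<open>The column of index \<open>j\<close> of \<open>F + u\<close>.  In a Capelli determinant the spectral parameter drops by one from
each column to the next; lists of columns carry this shift along with the position, not with the
index \<open>j\<close>, which is what makes exchanging two indices meaningful.\<close>

definition shifted_col :: "('i \<Rightarrow> 'i \<Rightarrow> 'a::ring_1) \<Rightarrow> 'a \<Rightarrow> 'i \<Rightarrow> 'i \<Rightarrow> 'a" where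
  "shifted_col F u j = (\<lambda>i. F i j + (if i = j then u else 0))"

primrec shifted_cols :: "('i \<Rightarrow> 'i \<Rightarrow> 'a::ring_1) \<Rightarrow> 'a \<Rightarrow> 'i list \<Rightarrow> ('i \<Rightarrow> 'a) list" where
  "shifted_cols F u [] = []"
| "shifted_cols F u (j # js) = shifted_col F u j # shifted_cols F (u - 1) js"

lemma length_shifted_cols [simp]: "length (shifted_cols F u js) = length js"
  by (induction js arbitrary: u) simp_all

lemma shifted_cols_append:
  "shifted_cols F u (xs @ ys) = shifted_cols F u xs @ shifted_cols F (u - of_nat (length xs)) ys"
  by (induction xs arbitrary: u) (simp_all add: algebra_simps)

lemma nth_shifted_cols:
  "p < length js \<Longrightarrow> shifted_cols F u js ! p = shifted_col F (u - of_nat p) (js ! p)"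
proof (induction js arbitrary: u p)
  case (Cons j js)
  then show ?case by (cases p) (simp_all add: algebra_simps)
qed simp

lemma shifted_cols_update:
  "p < length js \<Longrightarrow>
    (shifted_cols F u js)[p := shifted_col F (u - of_nat p) k] = shifted_cols F u (js[p := k])"
proof (induction js arbitrary: u p)
  case (Cons j js)
  show ?case
  proof (cases p)
    case (Suc q)
    then show ?thesis
      using Cons.IH[of q "u - 1"] Cons.prems by (simp add: diff_diff_add)
  qed simp
qed simp

definition capelli_det :: "('i::{finite, linorder} \<Rightarrow> 'i \<Rightarrow> 'a::ring_1) \<Rightarrow> 'a \<Rightarrow> 'a" where
  "capelli_det F u = cdet (shifted_cols F u inds)"

locale gl_matrix =
  fixes F :: "'i::{finite, linorder} \<Rightarrow> 'i \<Rightarrow> 'a::ring_1"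
  assumes gl_relation:
    "cmt (F i j) (F k l) = (if j = k then F i l else 0) - (if l = i then F k j else 0)"
begin

text \<open>The commutator of the entries of \<open>F\<close> contributes the first and the last term on the right, which are not
symmetric in \<open>a\<close> and \<open>b\<close>; the shift by one contributes the other two and makes the sum symmetric.
This symmetry is the exchange relation between adjacent columns.\<close>

lemma shifted_col_exchange:
  assumes u: "central u"
  shows "shifted_col F u i a * shifted_col F (u - 1) j b - shifted_col F u j b * shifted_col F (u - 1) i a =
    (if i = b then F a j else 0) - (if j = b then F a i else 0)
    + (if i = a then F b j else 0) - (if j = a then F b i else 0)"
proof -
  define d :: "'i \<Rightarrow> 'i \<Rightarrow> 'a" where "d x y = (if y = x then 1 else 0)" for x y
  have d: "d x y * z = z * d x y" for x y z
    by (simp add: d_def)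
  have col: "shifted_col F u y x = F x y + u * d x y" "shifted_col F (u - 1) y x = F x y + u * d x y - d x y" for x y
    by (auto simp: shifted_col_def d_def)
  have comm: "F x y * (u * d x' y') = u * d x' y' * F x y" "u * d x y * (u * d x' y') = u * d x' y' * (u * d x y)"
    "u * d x y * d x' y' = u * d x' y' * d x y" for x y x' y'
    by (simp_all add: d_def centralD[OF u])
  have "shifted_col F u i a * shifted_col F (u - 1) j b - shifted_col F u j b * shifted_col F (u - 1) i a =
    cmt (F a i) (F b j) - F a i * d b j + F b j * d a i"
    unfolding col by (simp add: cmt_def distrib_left distrib_right right_diff_distrib comm(1)[of a i b j]
        comm(1)[of b j a i] comm(2)[of a i b j] comm(3)[of a i b j])
  then show ?thesis
    unfolding gl_relation by (simp add: d_def)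
qed

lemma cdet_swap:
  assumes "central u" "length pre + 2 + length post = CARD('i)"
  shows "cdet (shifted_cols F u (pre @ i # j # post)) = - cdet (shifted_cols F u (pre @ j # i # post))"
proof -
  have "cdet (shifted_cols F u (pre @ i # j # post)) + cdet (shifted_cols F u (pre @ j # i # post)) = 0"
    unfolding shifted_cols_append shifted_cols.simps
  proof (rule cdet_symmetric_pairs)
    let ?u = "u - of_nat (length pre)"
    show "shifted_col F ?u i a * shifted_col F (?u - 1) j b + shifted_col F ?u j a * shifted_col F (?u - 1) i b =
        shifted_col F ?u i b * shifted_col F (?u - 1) j a + shifted_col F ?u j b * shifted_col F (?u - 1) i a" for a b
    proof -
      have cross: "p + s = r + q" if "p - q = r - s" for p q r s :: 'a
        using that by (simp add: diff_eq_eq add_ac add_diff_eq)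
      show ?thesis
        by (rule cross) (simp add: shifted_col_exchange[OF central_diff_of_nat[OF assms(1)]])
    qed
  qed (use assms in simp)
  then show ?thesis by (simp add: eq_neg_iff_add_eq_0)
qed

lemma cdet_adjacent_equal:
  assumes u: "central u" and "length pre + 2 + length post = CARD('i)"
  shows "cdet (shifted_cols F u (pre @ i # i # post)) = 0"
proof -
  let ?u = "u - of_nat (length pre)"
  have "shifted_col F ?u i a * shifted_col F (?u - 1) i b = shifted_col F ?u i b * shifted_col F (?u - 1) i a" for a b
    using shifted_col_exchange[OF central_diff_of_nat[OF u], of "length pre" i a i b] by (simp split: if_splits)
  then show ?thesis
    unfolding shifted_cols_append shifted_cols.simps
    by (intro cdet_symmetric_pair) (use assms in simp_all)
qed

text \<open>Moving one index over a block only permutes indices; the spectral parameters stay at their positions.\<close>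

lemma cdet_move:
  assumes "central u" "length pre + 1 + length post + length suf = CARD('i)"
  shows "cdet (shifted_cols F u (pre @ l # post @ suf)) =
    (- 1) ^ length post * cdet (shifted_cols F u (pre @ post @ l # suf))"
  using assms(2)
proof (induction post arbitrary: pre)
  case (Cons j post)
  have "cdet (shifted_cols F u (pre @ l # j # (post @ suf))) =
      - cdet (shifted_cols F u ((pre @ [j]) @ l # post @ suf))"
    using cdet_swap[OF assms(1), of pre "post @ suf" l j] Cons.prems by simp
  also have "\<dots> = - ((- 1) ^ length post * cdet (shifted_cols F u ((pre @ [j]) @ post @ l # suf)))"
    using Cons.IH[of "pre @ [j]"] Cons.prems by simp
  finally show ?case by simp
qed simp

lemma cdet_not_distinct:
  assumes "central u" "length js = CARD('i)" "\<not> distinct js"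
  shows "cdet (shifted_cols F u js) = 0"
proof -
  from not_distinct_decomp[OF assms(3)] obtain pre mid suf i where "js = pre @ [i] @ mid @ [i] @ suf"
    by blast
  then show ?thesis
    using cdet_move[OF assms(1), of pre mid "i # suf" i] cdet_adjacent_equal[OF assms(1), of "pre @ mid" suf i]
      assms(2) by simp
qed

lemma inds_decomp:
  obtains pre post where "(inds :: 'i list) = pre @ l # post" "l \<notin> set pre" "l \<notin> set post"
    "length pre + 1 + length post = CARD('i)" "set (pre @ post) = - {l}"
proof -
  have "l \<in> set inds" by simp
  then obtain pre post where *: "(inds :: 'i list) = pre @ l # post"
    by (meson split_list)
  have "distinct (pre @ l # post)" "set (pre @ l # post) = UNIV" "length (pre @ l # post) = CARD('i)"
    unfolding *[symmetric] by simp_all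
  then show ?thesis by (intro that[OF *]) auto
qed

text \<open>Replacing column index \<open>l\<close> by \<open>k\<close> gives zero by antisymmetry unless \<open>k = l\<close>.  With that column
moved to the end, where its entries are rightmost in every product and its shift is
\<open>u - (CARD('i) - 1)\<close>, expansion along it displays the determinant as a product with a cofactor
matrix on the left.\<close>

lemma capelli_left_adjugate:
  assumes u: "central u"
  shows "\<exists>A. \<forall>l k. (\<Sum>i\<in>UNIV. A l i * shifted_col F (u - of_nat (CARD('i) - 1)) k i) =
    (if l = k then capelli_det F u else 0)"
proof -
  have "\<exists>a. \<forall>k. (\<Sum>i\<in>UNIV. a i * shifted_col F (u - of_nat (CARD('i) - 1)) k i) =
    (if l = k then capelli_det F u else 0)" for l
  proof -
    obtain pre post where *: "(inds :: 'i list) = pre @ l # post" "l \<notin> set pre" "l \<notin> set post"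
      "length pre + 1 + length post = CARD('i)" "set (pre @ post) = - {l}"
      by (rule inds_decomp)
    define a where "a i = (- 1) ^ length post *
        cdet (shifted_cols F u (pre @ post) @ [\<lambda>j. if j = i then 1 else 0])" for i
    have card: "length (pre @ post) = CARD('i) - 1" using *(4) by simp
    have expand: "(\<Sum>i\<in>UNIV. a i * shifted_col F (u - of_nat (CARD('i) - 1)) k i) =
      (- 1) ^ length post * cdet (shifted_cols F u ((pre @ post) @ [k]))" for k
      unfolding shifted_cols_append[of F u "pre @ post"] card shifted_cols.simps
      by (subst cdet_expand_last) (use *(4) in \<open>simp_all add: a_def sum_distrib_left mult.assoc\<close>)
    have delta: "(- 1) ^ length post * cdet (shifted_cols F u ((pre @ post) @ [k])) = (if l = k then capelli_det F u else 0)" for k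
    proof (cases "l = k")
      case True
      then show ?thesis
        using cdet_move[OF u, of pre post "[]" l] *(1,4) by (simp add: capelli_det_def)
    next
      case False
      then have "\<not> distinct ((pre @ post) @ [k])" using *(5) by auto
      then show ?thesis
        using False cdet_not_distinct[OF u, of "(pre @ post) @ [k]"] *(4) by simp
    qed
    show ?thesis by (intro exI[of _ a] allI) (rule trans[OF expand delta])
  qed
  then have "\<forall>l. \<exists>a. \<forall>k. (\<Sum>i\<in>UNIV. a i * shifted_col F (u - of_nat (CARD('i) - 1)) k i) =
    (if l = k then capelli_det F u else 0)" ..
  then show ?thesis by (rule choice)
qed

text \<open>The mirror image: the column is moved to the front, where its entries are leftmost and its shift is \<open>u\<close>.
This is the transposed matrix with its cofactor matrix on the right.\<close>

lemma capelli_right_adjugate: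
  assumes u: "central u"
  shows "\<exists>B. \<forall>k l. (\<Sum>i\<in>UNIV. shifted_col F u k i * B i l) =
    (if k = l then capelli_det F u else 0)"
proof -
  have "\<exists>b. \<forall>k. (\<Sum>i\<in>UNIV. shifted_col F u k i * b i) =
    (if k = l then capelli_det F u else 0)" for l
  proof -
    obtain pre post where *: "(inds :: 'i list) = pre @ l # post" "l \<notin> set pre" "l \<notin> set post"
      "length pre + 1 + length post = CARD('i)" "set (pre @ post) = - {l}"
      by (rule inds_decomp)
    define b where "b i = (- 1) ^ length pre *
        cdet ((\<lambda>j. if j = i then 1 else 0) # shifted_cols F (u - 1) (pre @ post))" for i
    have comm: "x * ((- 1) ^ m * y) = (- 1) ^ m * (x * y)" for x y :: 'a and m
      by (cases "even m") simp_all
    have sign_square: "(- 1) ^ m * (- 1) ^ m = (1 :: 'a)" for m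
      by (cases "even m") simp_all
    have expand: "(\<Sum>i\<in>UNIV. shifted_col F u k i * b i) =
      (- 1) ^ length pre * cdet (shifted_cols F u (k # pre @ post))" for k
      unfolding shifted_cols.simps
      by (subst cdet_expand_first) (simp add: b_def sum_distrib_left comm)
    have delta: "(- 1) ^ length pre * cdet (shifted_cols F u (k # pre @ post)) = (if k = l then capelli_det F u else 0)" for k
    proof (cases "k = l")
      case True
      then show ?thesis
        using cdet_move[OF u, of "[]" pre post l] *(1,4)
        by (simp add: capelli_det_def mult.assoc[symmetric] sign_square)
    next
      case False
      then have "\<not> distinct (k # pre @ post)" using *(5) by auto
      then show ?thesis
        using False cdet_not_distinct[OF u, of "k # pre @ post"] *(4) by simp
    qed
    show ?thesis by (intro exI[of _ b] allI) (rule trans[OF expand delta])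
  qed
  then have "\<forall>l. \<exists>b. \<forall>k. (\<Sum>i\<in>UNIV. shifted_col F u k i * b i) =
    (if k = l then capelli_det F u else 0)" ..
  from choice[OF this] obtain B where "\<forall>l k. (\<Sum>i\<in>UNIV. shifted_col F u k i * B l i) =
    (if k = l then capelli_det F u else 0)" ..
  then show ?thesis by (intro exI[of _ "\<lambda>i l. B l i"]) simp
qed

end


section \<open>Centrality of the Capelli determinant\<close>

lemma cmt_prod_list:
  "cmt z (prod_list xs) = (\<Sum>p<length xs. prod_list (xs[p := cmt z (xs ! p)]))"
  for z :: "'a::ring_1"
proof (induction xs)
  case (Cons x xs)
  have "cmt z (prod_list (x # xs)) = cmt z x * prod_list xs + x * cmt z (prod_list xs)"
    by (simp add: cmt_def algebra_simps)
  then show ?case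
    by (simp add: Cons.IH sum.lessThan_Suc_shift sum_distrib_left del: sum.lessThan_Suc)
qed (simp add: cmt_one)

lemma map2_update:
  "length xs = length ys \<Longrightarrow> p < length xs \<Longrightarrow> map2 f (xs[p := x]) ys = (map2 f xs ys)[p := f x (ys ! p)]"
  by (simp add: list_eq_iff_nth_eq nth_list_update)

text \<open>A commutator is a derivation, so it acts on one column at a time.\<close>

lemma cmt_cdet:
  fixes z :: "'a::ring_1" and vs :: "('i::{finite, linorder} \<Rightarrow> 'a) list"
  assumes "length vs = CARD('i)"
  shows "cmt z (cdet vs) = (\<Sum>p<CARD('i). cdet (vs[p := \<lambda>i. cmt z ((vs ! p) i)]))"
proof -
  have int: "cmt z (of_int k * x) = of_int k * cmt z x" for k x
    by (simp add: cmt_def of_int_commute_left mult.assoc right_diff_distrib)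
  show ?thesis
    unfolding cdet_def cmt_sum int cmt_prod_list
    by (subst sum.swap) (auto simp: assms sum_distrib_left map2_update intro!: sum.cong)
qed

lemma cdet_update_diff:
  fixes vs :: "('i::{finite, linorder} \<Rightarrow> 'a::ring_1) list"
  assumes "length vs = CARD('i)" "p < CARD('i)"
  shows "cdet (vs[p := \<lambda>i. v i - w i]) = cdet (vs[p := v]) - cdet (vs[p := w])"
  using cdet_add[of "take p vs" "drop (Suc p) vs" "\<lambda>i. v i - w i" w] assms
  by (simp add: upd_conv_take_nth_drop)

lemma cdet_equal_rows:
  fixes vs :: "('i::{finite, linorder} \<Rightarrow> 'a::ring_1) list"
  assumes "a \<noteq> b" and eq: "\<And>v. v \<in> set vs \<Longrightarrow> v a = v b"
  shows "cdet vs = 0"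
proof -
  let ?\<tau> = "Transposition.transpose a b"
  define f where "f \<sigma> = of_int (sign \<sigma>) * prod_list (map2 (\<lambda>v j. v (\<sigma> j)) vs inds)" for \<sigma> :: "'i \<Rightarrow> 'i"
  have "cdet vs = (\<Sum>\<sigma> | \<sigma> permutes UNIV. f (inv \<sigma>))"
    unfolding cdet_def f_def by (rule sum_permutations_inverse)
  also have "\<dots> = 0"
  proof (rule sum_permutations_antisym[OF assms(1)])
    fix \<sigma> :: "'i \<Rightarrow> 'i" assume \<sigma>: "\<sigma> permutes UNIV"
    have "inv (\<sigma> \<circ> ?\<tau>) = ?\<tau> \<circ> inv \<sigma>"
      using \<sigma> by (simp add: o_inv_distrib permutes_bij)
    moreover have "sign (?\<tau> \<circ> inv \<sigma>) = - sign (inv \<sigma>)"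
    proof -
      have "permutation (inv \<sigma>)" using permutes_inv[OF \<sigma>] by (auto simp: permutation_permutes)
      then show ?thesis using assms(1) by (simp add: sign_compose sign_swap_id permutation_swap_id)
    qed
    moreover have "v (?\<tau> i) = v i" if "v \<in> set vs" for v i
      using eq[OF that] by (simp add: transpose_def)
    then have "map2 (\<lambda>v j. v ((?\<tau> \<circ> inv \<sigma>) j)) vs inds = map2 (\<lambda>v j. v (inv \<sigma> j)) vs inds"
      by (intro map_cong) (auto dest!: set_zip_leftD)
    ultimately show "f (inv (\<sigma> \<circ> ?\<tau>)) = - f (inv \<sigma>)"
      by (simp only: f_def of_int_minus mult_minus_left)
  qed
  finally show ?thesis .
qed

text \<open>The derivation of the Grassmann algebra given by the matrix unit \<open>(b, a)\<close> multiplies the top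
monomial by the trace of that matrix unit.\<close>

lemma sum_cdet_replace_row:
  fixes vs :: "('i::{finite, linorder} \<Rightarrow> 'a::ring_1) list"
  assumes len: "length vs = CARD('i)"
  shows "(\<Sum>p<CARD('i). cdet (vs[p := \<lambda>i. if i = b then (vs ! p) a else 0])) =
    (if a = b then cdet vs else 0)"
proof -
  define ws where "ws = map (\<lambda>v i. if i = b then v a else v i) vs"
  have "(\<Sum>p<CARD('i). prod_list (map2 (\<lambda>v j. v (\<sigma> j)) (vs[p := \<lambda>i. if i = b then (vs ! p) a else 0]) inds)) =
      prod_list (map2 (\<lambda>v j. v (\<sigma> j)) ws inds)" if \<sigma>: "\<sigma> permutes UNIV" for \<sigma> :: "'i \<Rightarrow> 'i"
  proof -
    obtain q where q: "q < CARD('i)" "(inds :: 'i list) ! q = inv \<sigma> b"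
      using in_set_conv_nth[of "inv \<sigma> b" inds] by auto
    have at_b: "\<sigma> (inds ! p) = b \<longleftrightarrow> p = q" if "p < CARD('i)" for p
    proof -
      have "\<sigma> (inds ! p) = b \<longleftrightarrow> (inds :: 'i list) ! p = inds ! q"
        using permutes_inverses[OF \<sigma>] q(2) by metis
      also have "\<dots> \<longleftrightarrow> p = q"
        using that q(1) by (simp add: nth_eq_iff_index_eq)
      finally show ?thesis .
    qed
    have "prod_list (map2 (\<lambda>v j. v (\<sigma> j)) (vs[p := \<lambda>i. if i = b then (vs ! p) a else 0]) inds) =
        (if p = q then prod_list (map2 (\<lambda>v j. v (\<sigma> j)) ws inds) else 0)" if p: "p < CARD('i)" for p
    proof (cases "p = q")
      case True
      have "map2 (\<lambda>v j. v (\<sigma> j)) (vs[q := \<lambda>i. if i = b then (vs ! q) a else 0]) inds =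
          map2 (\<lambda>v j. v (\<sigma> j)) ws inds"
        using len by (auto simp: list_eq_iff_nth_eq nth_list_update ws_def at_b)
      then show ?thesis by (simp only: True if_True refl)
    next
      case False
      let ?L = "map2 (\<lambda>v j. v (\<sigma> j)) (vs[p := \<lambda>i. if i = b then (vs ! p) a else 0]) inds"
      have "p < length ?L" using len p by simp
      then have "?L ! p \<in> set ?L" by (rule nth_mem)
      moreover have "?L ! p = 0" using len p False by (simp add: at_b)
      ultimately have "0 \<in> set ?L" by (simp only:)
      moreover have "prod_list zs = 0" if "0 \<in> set zs" for zs :: "'a list"
        using that by (induction zs) auto
      ultimately show ?thesis using False by simp
    qed
    then show ?thesis using q(1) by simp
  qed
  then have "(\<Sum>p<CARD('i). cdet (vs[p := \<lambda>i. if i = b then (vs ! p) a else 0])) = cdet ws"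
    unfolding cdet_def by (subst sum.swap) (auto simp flip: sum_distrib_left intro!: sum.cong)
  also have "\<dots> = (if a = b then cdet vs else 0)"
  proof (cases "a = b")
    case True
    then have "ws = vs" by (auto simp: ws_def intro!: map_idI)
    with True show ?thesis by simp
  next
    case False
    have "v a = v b" if "v \<in> set ws" for v
      using that by (auto simp: ws_def)
    from cdet_equal_rows[OF False this] False show ?thesis by simp
  qed
  finally show ?thesis .
qed

context gl_matrix
begin

text \<open>Bracketing with \<open>F a b\<close> acts on \<open>F\<close> through the row index and through the column index; scalar matrices are
fixed, so the same holds for \<open>F + u\<close>.\<close>

lemma cmt_shifted_col:
  assumes "central u"
  shows "cmt (F a b) (shifted_col F u j i) =
    (if i = b then shifted_col F u j a else 0) - (if j = a then shifted_col F u b i else 0)"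
  using gl_relation[of a b i j] centralD[OF assms, of "F a b"]
  by (auto simp: shifted_col_def cmt_simps) (auto simp: cmt_def)

text \<open>Centrality of the Capelli determinant: the action on row indices and the action on column indices
both contribute \<open>\<delta>\<^sub>a\<^sub>b\<close> times the determinant, with opposite signs.\<close>

lemma cmt_capelli_det:
  assumes u: "central u"
  shows "cmt (F a b) (capelli_det F u) = 0"
proof -
  let ?N = "CARD('i)" and ?vs = "shifted_cols F u inds"
  have step: "cdet (?vs[p := \<lambda>i. cmt (F a b) ((?vs ! p) i)]) =
      cdet (?vs[p := \<lambda>i. if i = b then (?vs ! p) a else 0]) -
      (if inds ! p = a then cdet (shifted_cols F u (inds[p := b])) else 0)" if p: "p < ?N" for p
  proof -
    let ?u = "u - of_nat p"
    have "(\<lambda>i. cmt (F a b) ((?vs ! p) i)) = (\<lambda>i. (if i = b then (?vs ! p) a else 0) -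
        (if inds ! p = a then shifted_col F ?u b i else 0))"
      using p by (auto simp: fun_eq_iff nth_shifted_cols cmt_shifted_col[OF central_diff_of_nat[OF u]])
    then have "cdet (?vs[p := \<lambda>i. cmt (F a b) ((?vs ! p) i)]) =
        cdet (?vs[p := \<lambda>i. if i = b then (?vs ! p) a else 0]) -
        cdet (?vs[p := \<lambda>i. if inds ! p = a then shifted_col F ?u b i else 0])"
      using p by (simp add: cdet_update_diff)
    moreover have "cdet (?vs[p := \<lambda>_. 0]) = 0"
      using cdet_update_diff[of ?vs p "\<lambda>_. 0" "\<lambda>_. 0"] p by simp
    ultimately show ?thesis
      using p shifted_cols_update[of p inds F u b] by auto
  qed
  \<comment> \<open>The action on column indices affects only the column of index \<open>a\<close>, which it replaces by that of index \<open>b\<close>.\<close>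
  obtain q where q: "q < ?N" "(inds :: 'i list) ! q = a"
    using in_set_conv_nth[of a inds] by auto
  have at_a: "inds ! p = a \<longleftrightarrow> p = q" if "p < ?N" for p
    using that q nth_eq_iff_index_eq[of "inds :: 'i list" p q] by auto
  have "cmt (F a b) (capelli_det F u) = (\<Sum>p<?N. cdet (?vs[p := \<lambda>i. if i = b then (?vs ! p) a else 0])) -
      (\<Sum>p<?N. if p = q then cdet (shifted_cols F u (inds[p := b])) else 0)"
    unfolding capelli_det_def by (subst cmt_cdet) (simp_all add: step at_a sum_subtractf)
  also have "\<dots> = (if a = b then capelli_det F u else 0) - cdet (shifted_cols F u (inds[q := b]))"
    using q(1) by (simp add: sum_cdet_replace_row capelli_det_def)
  also have "cdet (shifted_cols F u (inds[q := b])) = (if a = b then capelli_det F u else 0)"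
  proof (cases "a = b")
    case True
    with q show ?thesis by (metis capelli_det_def list_update_id)
  next
    case False
    obtain r where r: "r < ?N" "(inds :: 'i list) ! r = b"
      using in_set_conv_nth[of b inds] by auto
    with q False have "r \<noteq> q" by auto
    have "\<not> distinct ((inds :: 'i list)[q := b])"
    proof
      assume "distinct ((inds :: 'i list)[q := b])"
      from nth_eq_iff_index_eq[OF this, of r q] show False
        using q(1) r \<open>r \<noteq> q\<close> by simp
    qed
    with False show ?thesis by (simp add: cdet_not_distinct[OF u])
  qed
  finally show ?thesis by simp
qed

end


section \<open>Splitting off a row and a column\<close>

lemma inds_option: "(inds :: 'n::{finite, linorder} option list) = None # map Some inds"
proof (rule sorted_distinct_set_unique)
  have "set (inds :: 'n option list) = UNIV" by (rule set_sorted_list_of_set) simp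
  then show "set (inds :: 'n option list) = set (None # map Some inds)"
    by (simp add: UNIV_option_conv)
  show "sorted (None # map Some (inds :: 'n list))"
    by (simp add: sorted_map)
qed (simp_all add: distinct_map)

abbreviation zero_row :: "('n \<Rightarrow> 'a::zero) \<Rightarrow> 'n option \<Rightarrow> 'a" where
  "zero_row v \<equiv> case_option 0 v"

lemma map_permutation_Some: "map_permutation UNIV Some \<tau> = map_option \<tau>"
proof
  fix z show "map_permutation UNIV Some \<tau> z = map_option \<tau> z"
    by (cases z) (auto simp: map_permutation_def restrict_id_def)
qed

text \<open>Only permutations that send \<open>None\<close> to \<open>None\<close> contribute, because all columns but the first vanish at \<open>None\<close>.\<close>

lemma cdet_zero_row:
  fixes x :: "'n::{finite, linorder} option \<Rightarrow> 'a::ring_1"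
  assumes x: "x None = 1" and len: "length ws = CARD('n)"
  shows "cdet (x # map zero_row ws) = cdet ws"
proof -
  define f where "f \<sigma> = of_int (sign \<sigma>) *
      (x (\<sigma> None) * prod_list (map2 (\<lambda>w j. zero_row w (\<sigma> (Some j))) ws inds))" for \<sigma> :: "'n option \<Rightarrow> 'n option"
  define g where "g \<tau> = of_int (sign \<tau>) * prod_list (map2 (\<lambda>w j. w (\<tau> j)) ws inds)" for \<tau> :: "'n \<Rightarrow> 'n"
  have "cdet (x # map zero_row ws) = (\<Sum>\<sigma> | \<sigma> permutes UNIV. f \<sigma>)"
    by (simp add: cdet_def f_def inds_option zip_map1 zip_map2 o_def case_prod_unfold)
  also have "\<dots> = (\<Sum>\<sigma> | \<sigma> permutes UNIV \<and> \<sigma> None = None. f \<sigma>)"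
  proof (rule sum.mono_neutral_right)
    show "\<forall>\<sigma>\<in>{\<sigma>. \<sigma> permutes UNIV} - {\<sigma>. \<sigma> permutes UNIV \<and> \<sigma> None = None}. f \<sigma> = 0"
    proof
      fix \<sigma> :: "'n option \<Rightarrow> 'n option"
      assume "\<sigma> \<in> {\<sigma>. \<sigma> permutes UNIV} - {\<sigma>. \<sigma> permutes UNIV \<and> \<sigma> None = None}"
      then have \<sigma>: "\<sigma> permutes UNIV" "\<sigma> None \<noteq> None" by auto
      from permutes_surj[OF \<sigma>(1)] obtain k where "None = \<sigma> k" by (rule surjE)
      with \<sigma>(2) obtain j where j: "\<sigma> (Some j) = None" by (metis not_None_eq)
      obtain p where p: "p < CARD('n)" "(inds :: 'n list) ! p = j"
        using in_set_conv_nth[of j inds] by auto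
      let ?L = "map2 (\<lambda>w j. zero_row w (\<sigma> (Some j))) ws inds"
      have "p < length ?L" using len p by simp
      then have "?L ! p \<in> set ?L" by (rule nth_mem)
      moreover have "?L ! p = 0" using len p j by simp
      ultimately have "0 \<in> set ?L" by (simp only:)
      moreover have "prod_list zs = 0" if "0 \<in> set zs" for zs :: "'a list"
        using that by (induction zs) auto
      ultimately show "f \<sigma> = 0" by (simp add: f_def)
    qed
  qed auto
  also have "\<dots> = (\<Sum>\<tau> | \<tau> permutes UNIV. g \<tau>)"
  proof (rule sum.reindex_bij_witness[where j = "\<lambda>\<sigma> a. the (\<sigma> (Some a))" and i = map_option])
    fix \<sigma> :: "'n option \<Rightarrow> 'n option"
    assume "\<sigma> \<in> {\<sigma>. \<sigma> permutes UNIV \<and> \<sigma> None = None}"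
    then have \<sigma>: "inj \<sigma>" "\<sigma> None = None" by (auto intro: permutes_inj)
    define \<tau> where "\<tau> a = the (\<sigma> (Some a))" for a
    have \<tau>: "(\<lambda>a. the (\<sigma> (Some a))) = \<tau>"
      by (simp add: \<tau>_def fun_eq_iff)
    have Some: "\<sigma> (Some a) = Some (\<tau> a)" for a
    proof (cases "\<sigma> (Some a)")
      case None
      with \<sigma> have "Some a = None" by (metis injD)
      then show ?thesis by simp
    qed (simp add: \<tau>_def)
    have eq: "map_option \<tau> = \<sigma>"
    proof
      fix z show "map_option \<tau> z = \<sigma> z" by (cases z) (simp_all add: Some \<sigma>(2))
    qed
    have "inj \<tau>"
    proof (rule injI)
      fix a b assume "\<tau> a = \<tau> b"
      then have "\<sigma> (Some a) = \<sigma> (Some b)" by (simp add: Some)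
      with \<sigma>(1) show "a = b" by (auto dest: injD)
    qed
    then have "bij \<tau>"
      by (simp add: bij_def finite_UNIV_inj_surj)
    then have mem: "\<tau> permutes UNIV"
      by (intro bij_imp_permutes) auto
    have sign: "sign \<tau> = sign \<sigma>"
      using map_permutation_Some[of \<tau>] eq mem sign_map_permutation[of Some UNIV \<tau>] by simp
    show "map_option (\<lambda>a. the (\<sigma> (Some a))) = \<sigma>"
      by (simp only: \<tau> eq)
    show "(\<lambda>a. the (\<sigma> (Some a))) \<in> {\<tau>. \<tau> permutes UNIV}"
      using mem by (simp only: \<tau> mem_Collect_eq)
    have "g \<tau> = f \<sigma>"
      by (simp add: f_def g_def \<sigma>(2) x Some sign)
    then show "g (\<lambda>a. the (\<sigma> (Some a))) = f \<sigma>"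
      by (simp only: \<tau>)
  next
    fix \<tau> :: "'n \<Rightarrow> 'n" assume "\<tau> \<in> {\<tau>. \<tau> permutes UNIV}"
    then have "map_permutation UNIV Some \<tau> permutes range Some"
      by (intro map_permutation_permutes) (auto simp: bij_betw_def)
    then show "map_option \<tau> \<in> {\<sigma>. \<sigma> permutes UNIV \<and> \<sigma> None = None}"
      by (auto simp: map_permutation_Some intro: permutes_subset)
  qed auto
  also have "\<dots> = cdet ws"
    by (simp add: cdet_def g_def)
  finally show ?thesis .
qed

text \<open>Behind the vector \<open>x\<close> the rank one part \<open>x a * d b\<close> of a column drops out, since \<open>x\<close> squares to zero in the
Grassmann algebra.  The entries of \<open>x\<close> commute with the remaining column, so \<open>x\<close> can be
moved behind it, where it meets the next column.\<close>

lemma cdet_strip_multiples: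
  fixes x :: "'n::{finite, linorder} option \<Rightarrow> 'a::ring_1"
  assumes u: "central u"
    and x: "\<And>a b. x a * x b = x b * x a"
    and M: "\<And>a b. M a (Some b) = zero_row (\<lambda>a. N a b) a + x a * d b"
    and N: "\<And>a b c. x c * N a b = N a b * x c"
    and len: "length pre + 1 + length js = CARD('n option)"
  shows "cdet (pre @ x # shifted_cols M u (map Some js)) = cdet (pre @ x # map zero_row (shifted_cols N u js))"
  using u len
proof (induction js arbitrary: pre u)
  case (Cons j js)
  let ?e = "zero_row (shifted_col N u j)"
  let ?C = "shifted_cols M (u - 1) (map Some js)" and ?C' = "map zero_row (shifted_cols N (u - 1) js)"
  have xe: "x b * ?e a = ?e a * x b" for a b
    by (cases a) (simp_all add: shifted_col_def distrib_left distrib_right N centralD[OF Cons.prems(1)])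
  have anti: "cdet (pre @ x # ?e # post) = - cdet (pre @ ?e # x # post)" if "length post = length js" for post
  proof -
    have "cdet (pre @ x # ?e # post) + cdet (pre @ ?e # x # post) = 0"
      by (rule cdet_symmetric_pairs) (use that Cons.prems in \<open>simp_all add: xe add.commute\<close>)
    then show ?thesis by (simp add: eq_neg_iff_add_eq_0)
  qed
  have null: "cdet (pre @ x # (\<lambda>a. x a * d j) # ?C) = 0"
    by (rule cdet_symmetric_pair) (use Cons.prems in \<open>simp_all add: x flip: mult.assoc\<close>)
  have "shifted_col M u (Some j) = (\<lambda>a. ?e a + x a * d j)"
    by (auto simp: fun_eq_iff shifted_col_def M split: option.split)
  then have "cdet (pre @ x # shifted_cols M u (map Some (j # js))) = cdet ((pre @ [x]) @ (\<lambda>a. ?e a + x a * d j) # ?C)"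
    by simp
  also have "\<dots> = cdet ((pre @ [x]) @ ?e # ?C)"
    by (subst cdet_add) (use Cons.prems null in simp_all)
  also have "\<dots> = - cdet ((pre @ [?e]) @ x # ?C)"
    using anti[of ?C] by simp
  also have "\<dots> = - cdet ((pre @ [?e]) @ x # ?C')"
    using Cons.IH[of "u - 1" "pre @ [?e]"] Cons.prems by (simp add: central_diff_one)
  also have "\<dots> = cdet (pre @ x # map zero_row (shifted_cols N u (j # js)))"
    using anti[of ?C'] by simp
  finally show ?case .
qed simp

text \<open>Adding to the first column the combination of the others with coefficients \<open>x (Some i)\<close> on the left
turns it into \<open>(S + u) * x a\<close>; the added terms have determinant zero because they repeat an index
(the shifts are those of the list \<open>Some i # map Some inds\<close>).  Then the rank one parts of the
other columns are stripped off and the row \<open>None\<close> is removed.\<close>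

lemma capelli_det_factor:
  fixes x :: "'n::{finite, linorder} option \<Rightarrow> 'a::ring_1"
  assumes gl: "gl_matrix M" and u: "central u"
    and x: "x None = 1" "\<And>a b. x a * x b = x b * x a"
    and M: "\<And>a b. M a (Some b) = zero_row (\<lambda>a. N a b) a + x a * d b"
    and N: "\<And>a b c. x c * N a b = N a b * x c"
    and S: "\<And>a. M a None + (\<Sum>i\<in>UNIV. x (Some i) * M a (Some i)) = S * x a"
  shows "capelli_det M u = (S + u) * capelli_det N (u - 1)"
proof -
  interpret gl_matrix M by (rule gl)
  let ?R = "shifted_cols M (u - 1) (map Some inds)"
  let ?K = "\<lambda>a. cdet ((\<lambda>i. if i = a then 1 else 0) # ?R)"
  have xu: "x a * u = u * x a" for a
    using centralD[OF u] by simp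
  have first: "shifted_col M u None a = (S + u) * x a - (\<Sum>i\<in>UNIV. x (Some i) * shifted_col M u (Some i) a)" for a
  proof -
    have "(\<Sum>i\<in>UNIV. x (Some i) * shifted_col M u (Some i) a) =
      (\<Sum>i\<in>UNIV. x (Some i) * M a (Some i)) + (\<Sum>i\<in>UNIV. if a = Some i then x a * u else 0)"
      unfolding sum.distrib[symmetric] by (rule sum.cong) (auto simp: shifted_col_def distrib_left)
    also have "(\<Sum>i\<in>UNIV. if a = Some i then x a * u else 0) = (if a = None then 0 else u * x a)"
      by (cases a) (simp_all add: xu)
    finally show ?thesis
      using S[of a] x(1) by (auto simp: shifted_col_def algebra_simps)
  qed
  \<comment> \<open>The index \<open>Some i\<close> occurs twice: as the first column and in its own place.\<close>
  have zero: "(\<Sum>a\<in>UNIV. shifted_col M u (Some i) a * ?K a) = 0" for i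
    using cdet_not_distinct[OF u, of "Some i # map Some inds"]
    unfolding shifted_cols.simps cdet_expand_first[symmetric] by simp
  have "capelli_det M u = cdet (shifted_col M u None # ?R)"
    by (simp add: capelli_det_def inds_option)
  also have "\<dots> = (\<Sum>a\<in>UNIV. shifted_col M u None a * ?K a)"
    by (rule cdet_expand_first)
  also have "\<dots> = (S + u) * (\<Sum>a\<in>UNIV. x a * ?K a) -
      (\<Sum>i\<in>UNIV. x (Some i) * (\<Sum>a\<in>UNIV. shifted_col M u (Some i) a * ?K a))"
  proof -
    have "(\<Sum>i\<in>UNIV. x (Some i) * (\<Sum>a\<in>UNIV. shifted_col M u (Some i) a * ?K a)) =
        (\<Sum>a\<in>UNIV. \<Sum>i\<in>UNIV. x (Some i) * shifted_col M u (Some i) a * ?K a)"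
      unfolding sum_distrib_left mult.assoc[symmetric] by (rule sum.swap)
    then show ?thesis
      unfolding first by (simp add: left_diff_distrib sum_subtractf sum_distrib_left sum_distrib_right mult.assoc)
  qed
  also have "\<dots> = (S + u) * cdet (x # ?R)"
    unfolding zero cdet_expand_first[of x] by simp
  also have "cdet (x # ?R) = capelli_det N (u - 1)"
    using cdet_strip_multiples[where x = x and M = M and N = N and d = d and u = "u - 1"
        and pre = "[]" and js = inds, OF central_diff_one[OF u] x(2) M N]
    by (simp add: capelli_det_def cdet_zero_row x(1))
  finally show ?thesis .
qed


section \<open>Polynomials with a central variable\<close>

lemma nat_poly_induct [case_names zero single add]:
  fixes p :: "nat \<Rightarrow>\<^sub>0 'a::ring_1"
  assumes "P 0" and "\<And>k c. P (Poly_Mapping.single k c)" and "\<And>p q. P p \<Longrightarrow> P q \<Longrightarrow> P (p + q)"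
  shows "P p"
proof (induction p rule: update_induct)
  case const
  then show ?case by (simp add: assms)
next
  case (update f a b)
  have "Poly_Mapping.update a b f = f + Poly_Mapping.single a b"
    using update by (intro poly_mapping_eqI)
      (auto simp: lookup_update lookup_add lookup_single when_def in_keys_iff)
  with update assms show ?case by simp
qed

lemma polyT_central: "central (polyT :: nat \<Rightarrow>\<^sub>0 'a::ring_1)"
  unfolding central_def
proof
  fix p :: "nat \<Rightarrow>\<^sub>0 'a"
  show "polyT * p = p * polyT"
    by (induction p rule: nat_poly_induct) (simp_all add: polyT_def mult_single distrib_left distrib_right)
qed

lemma pconst_add: "pconst (a + b) = pconst a + pconst b"
  by (simp add: pconst_def single_add)

lemma pconst_diff: "pconst (a - b) = pconst a - pconst b" for a b :: "'a::ring_1"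
  by (simp add: pconst_def single_diff)

lemma pconst_mult: "pconst (a * b) = pconst a * pconst b" for a b :: "'a::ring_1"
  by (simp add: pconst_def mult_single)

lemma pconst_zero: "pconst 0 = 0"
  by (simp add: pconst_def)

lemma pconst_one: "pconst 1 = (1 :: nat \<Rightarrow>\<^sub>0 'a::ring_1)"
  by (simp add: pconst_def)

lemma pconst_sum: "pconst (sum f A) = (\<Sum>i\<in>A. pconst (f i))" for f :: "'b \<Rightarrow> 'a::ring_1"
  by (induction A rule: infinite_finite_induct) (simp_all add: pconst_add pconst_zero)

lemma pconst_of_nat: "pconst (of_nat n) = (of_nat n :: nat \<Rightarrow>\<^sub>0 'a::ring_1)"
  by (induction n) (simp_all add: pconst_zero pconst_add pconst_one)

lemma pconst_cmt: "cmt (pconst a) (pconst b) = pconst (cmt a b)" for a b :: "'a::ring_1"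
  by (simp add: cmt_def pconst_mult pconst_diff)

lemma lookup_pconst_mult:
  "Poly_Mapping.lookup (pconst a * p) m = a * Poly_Mapping.lookup p m"
  "Poly_Mapping.lookup (p * pconst a) m = Poly_Mapping.lookup p m * a" for a :: "'a::ring_1"
  by (induction p rule: nat_poly_induct)
    (simp_all add: pconst_def mult_single lookup_single lookup_add distrib_left distrib_right when_def)

lemma gl_matrix_pconst:
  assumes "\<And>i j k l. cmt (f i j) (f k l) = (if j = k then f i l else 0) - (if l = i then f k j else 0)"
  shows "gl_matrix (\<lambda>i j. pconst (f i j))"
  by unfold_locales (simp add: pconst_cmt assms pconst_diff pconst_zero)

text \<open>This matches the shift by the index in the Capelli matrix with the shift by the position in a list.\<close>

lemma index_nth_inds:
  assumes "p < CARD('i::{finite, linorder})"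
  shows "index ((inds :: 'i list) ! p) = p"
proof -
  let ?xs = "inds :: 'i list"
  have "{j. j < ?xs ! p} = (!) ?xs ` {..<p}"
  proof (intro equalityI subsetI)
    fix j assume "j \<in> {j. j < ?xs ! p}"
    then have j: "j < ?xs ! p" by simp
    obtain q where q: "q < CARD('i)" "?xs ! q = j"
      using in_set_conv_nth[of j ?xs] by auto
    have "q < p"
    proof (rule ccontr)
      assume "\<not> q < p"
      then have "?xs ! p \<le> ?xs ! q" using q(1) by (intro sorted_nth_mono) auto
      with j q(2) show False by simp
    qed
    with q(2) show "j \<in> (!) ?xs ` {..<p}" by auto
  next
    fix j assume "j \<in> (!) ?xs ` {..<p}"
    then obtain q where q: "q < p" "j = ?xs ! q" by auto
    have "?xs ! q \<le> ?xs ! p" using q(1) assms by (intro sorted_nth_mono) auto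
    moreover have "?xs ! q \<noteq> ?xs ! p" using q(1) assms by (simp add: nth_eq_iff_index_eq)
    ultimately show "j \<in> {j. j < ?xs ! p}" using q(2) by simp
  qed
  moreover have "inj_on ((!) ?xs) {..<p}"
    using assms by (auto simp: inj_on_def nth_eq_iff_index_eq)
  ultimately show ?thesis by (simp add: index_def card_image)
qed

lemma col_det_eq_capelli_det:
  fixes f :: "'i::{finite, linorder} \<Rightarrow> 'i \<Rightarrow> 'a::ring_1"
  shows "col_det (\<lambda>i j. pconst (f i j) - (if i = j then polyT + of_nat (index i) else 0)) =
    capelli_det (\<lambda>i j. pconst (f i j)) (- polyT)"
proof -
  have "map (\<lambda>j i. pconst (f i j) - (if i = j then polyT + of_nat (index i) else 0)) inds =
      shifted_cols (\<lambda>i j. pconst (f i j)) (- polyT) inds"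
    by (auto simp: list_eq_iff_nth_eq nth_shifted_cols shifted_col_def index_nth_inds fun_eq_iff)
  then show ?thesis by (simp add: col_det_eq_cdet capelli_det_def)
qed

lemma lookup_map_zero: "h 0 = 0 \<Longrightarrow> Poly_Mapping.lookup (Poly_Mapping.map h p) m = h (Poly_Mapping.lookup p m)"
  by (simp add: map.rep_eq when_def)

lemma map_col_det_shifted:
  fixes h :: "'a::complex_algebra_1 \<Rightarrow> 'b::complex_algebra_1"
    and f :: "'i::{finite, linorder} \<Rightarrow> 'i \<Rightarrow> 'a"
  assumes "alg_hom h"
  shows "Poly_Mapping.map h (col_det (\<lambda>i j. pconst (f i j) - (if i = j then polyT + of_nat (g i) else 0))) =
    col_det (\<lambda>i j. pconst (h (f i j)) - (if i = j then polyT + of_nat (g i) else 0))"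
proof -
  have h: "h 1 = 1" "h (x + y) = h x + h y" "h (x * y) = h x * h y" for x y
    using assms by (auto simp: alg_hom_def)
  have h0: "h 0 = 0" using h(2)[of 0 0] by simp
  have hd: "h (x - y) = h x - h y" for x y using h(2)[of "x - y" y] by simp
  have map_single: "Poly_Mapping.map h (Poly_Mapping.single m a) = Poly_Mapping.single m (h a)" for m a
    by (rule poly_mapping_eqI) (simp add: lookup_map_zero h0 lookup_single when_def)
  have add: "Poly_Mapping.map h (p + q) = Poly_Mapping.map h p + Poly_Mapping.map h q" for p q :: "nat \<Rightarrow>\<^sub>0 'a"
    by (rule poly_mapping_eqI) (simp add: lookup_map_zero h0 lookup_add h)
  have diff: "Poly_Mapping.map h (p - q) = Poly_Mapping.map h p - Poly_Mapping.map h q" for p q :: "nat \<Rightarrow>\<^sub>0 'a"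
    by (rule poly_mapping_eqI) (simp add: lookup_map_zero h0 lookup_minus hd)
  have zero: "Poly_Mapping.map h (0 :: nat \<Rightarrow>\<^sub>0 'a) = 0"
    by (rule poly_mapping_eqI) (simp add: lookup_map_zero h0)
  have one: "Poly_Mapping.map h (1 :: nat \<Rightarrow>\<^sub>0 'a) = 1"
    using map_single[of 0 1] by (simp add: h)
  have mult: "Poly_Mapping.map h (p * q) = Poly_Mapping.map h p * Poly_Mapping.map h q" for p q :: "nat \<Rightarrow>\<^sub>0 'a"
  proof (induction p rule: nat_poly_induct)
    case (single k c)
    show ?case
      by (induction q rule: nat_poly_induct) (simp_all add: map_single mult_single h zero add distrib_left)
  qed (simp_all add: zero add distrib_right)
  have nat: "Poly_Mapping.map h (of_nat n :: nat \<Rightarrow>\<^sub>0 'a) = of_nat n" for n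
    by (induction n) (simp_all add: zero one add)
  have int: "Poly_Mapping.map h (of_int k :: nat \<Rightarrow>\<^sub>0 'a) = of_int k" for k
  proof (cases k rule: int_cases2)
    case (nonpos n)
    then show ?thesis using diff[of 0 "of_nat n"] by (simp add: zero nat)
  qed (simp add: nat)
  have prod: "Poly_Mapping.map h (prod_list ps) = prod_list (map (Poly_Mapping.map h) ps)" for ps :: "(nat \<Rightarrow>\<^sub>0 'a) list"
    by (induction ps) (simp_all add: one mult)
  have sum: "Poly_Mapping.map h (sum p S) = (\<Sum>i\<in>S. Poly_Mapping.map h (p i))"
    for p :: "('i \<Rightarrow> 'i) \<Rightarrow> nat \<Rightarrow>\<^sub>0 'a" and S
    by (induction S rule: infinite_finite_induct) (simp_all add: zero add)
  have entry: "Poly_Mapping.map h (pconst a - (if P then polyT + of_nat n else 0)) =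
      pconst (h a) - (if P then polyT + of_nat n else 0)" for a P n
    by (simp add: diff add zero nat pconst_def polyT_def map_single h)
  show ?thesis
    by (simp only: col_det_def sum mult int prod list.map_comp o_def entry)
qed


section \<open>Evaluation of polynomials at matrices\<close>

text \<open>The coefficients need not commute with the values substituted for the powers of the variable, so
there are two evaluations.  The weights \<open>w m\<close> will be entries of the matrix powers.\<close>

definition left_eval :: "(nat \<Rightarrow> 'a::ring_1) \<Rightarrow> (nat \<Rightarrow>\<^sub>0 'a) \<Rightarrow> 'a" where
  "left_eval w p = (\<Sum>m\<in>Poly_Mapping.keys p. Poly_Mapping.lookup p m * w m)"

definition right_eval :: "(nat \<Rightarrow> 'a::ring_1) \<Rightarrow> (nat \<Rightarrow>\<^sub>0 'a) \<Rightarrow> 'a" where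
  "right_eval w p = (\<Sum>m\<in>Poly_Mapping.keys p. w m * Poly_Mapping.lookup p m)"

lemma left_eval_add: "left_eval w (p + q) = left_eval w p + left_eval w q"
  unfolding left_eval_def by (rule setsum_keys_plus_distrib) (simp_all add: distrib_right)

lemma right_eval_add: "right_eval w (p + q) = right_eval w p + right_eval w q"
  unfolding right_eval_def by (rule setsum_keys_plus_distrib) (simp_all add: distrib_left)

lemma eval_zero [simp]: "left_eval w 0 = 0" "right_eval w 0 = 0"
  by (simp_all add: left_eval_def right_eval_def)

lemma eval_single [simp]:
  "left_eval w (Poly_Mapping.single m c) = c * w m" "right_eval w (Poly_Mapping.single m c) = w m * c"
  by (simp_all add: left_eval_def right_eval_def)

lemma eval_diff:
  "left_eval w (p - q) = left_eval w p - left_eval w q"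
  "right_eval w (p - q) = right_eval w p - right_eval w q"
  using left_eval_add[of w "p - q" q] right_eval_add[of w "p - q" q] by simp_all

lemma eval_sum:
  "left_eval w (sum f A) = (\<Sum>i\<in>A. left_eval w (f i))"
  "right_eval w (sum f A) = (\<Sum>i\<in>A. right_eval w (f i))"
  by (induction A rule: infinite_finite_induct) (simp_all add: left_eval_add right_eval_add)

lemma eval_polyT:
  "left_eval w (p * polyT) = left_eval (\<lambda>m. w (Suc m)) p"
  "right_eval w (polyT * p) = right_eval (\<lambda>m. w (Suc m)) p"
  by (induction p rule: nat_poly_induct)
    (simp_all add: left_eval_add right_eval_add distrib_left distrib_right polyT_def mult_single)

lemma eval_pconst:
  "left_eval w (p * pconst a) = left_eval (\<lambda>m. a * w m) p"
  "right_eval w (pconst a * p) = right_eval (\<lambda>m. w m * a) p"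
  by (induction p rule: nat_poly_induct)
    (simp_all add: left_eval_add right_eval_add distrib_left distrib_right pconst_def mult_single mult.assoc)

lemma eval_weight_sum:
  "left_eval (\<lambda>m. \<Sum>k\<in>A. w k m) p = (\<Sum>k\<in>A. left_eval (w k) p)"
  "right_eval (\<lambda>m. \<Sum>k\<in>A. w k m) p = (\<Sum>k\<in>A. right_eval (w k) p)"
  unfolding left_eval_def right_eval_def
  by (simp_all add: sum_distrib_left sum_distrib_right) (rule sum.swap)+

lemma eval_mat_nth:
  fixes A :: "'a::ring_1 ^ 'k ^ 'k"
  shows "eval_mat p A $ i $ j = left_eval (\<lambda>m. mat_power A m $ i $ j) p"
proof -
  have "(mat c ** B) $ i $ j = c * B $ i $ j" for c and B :: "'a ^ 'k ^ 'k"
    by (simp add: matrix_matrix_mult_def mat_def if_distrib[where f = "\<lambda>x. x * b" for b] cong: if_cong)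
  then show ?thesis by (simp add: eval_mat_def left_eval_def)
qed

lemma mat_power_add: "mat_power A (k + m) = mat_power A k ** mat_power A m"
  by (induction k) (simp_all add: matrix_mul_assoc)

lemma mat_power_Suc_right: "mat_power A (Suc m) = mat_power A m ** A"
  using mat_power_add[of A m 1] by simp

text \<open>The coefficients of \<open>q\<close> stand to the left of those of \<open>r\<close>, and the remaining power of \<open>A\<close> can be split off
on the right, where it multiplies \<open>eval_mat r A\<close>.\<close>

lemma eval_mat_mult:
  fixes A :: "'a::ring_1 ^ 'k ^ 'k"
  assumes "eval_mat r A = 0"
  shows "eval_mat (q * r) A = 0"
proof -
  have zero: "left_eval (\<lambda>m. mat_power A m $ i $ j) r = 0" for i j
    using assms by (simp flip: eval_mat_nth)
  have "left_eval (\<lambda>m. mat_power A m $ i $ j) (q * r) = 0" for i j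
  proof (induction q rule: nat_poly_induct)
    case (single k c)
    have "left_eval w (Poly_Mapping.single k c * p) = c * left_eval (\<lambda>m. w (m + k)) p" for w p
      by (induction p rule: nat_poly_induct)
        (simp_all add: mult_single distrib_left left_eval_add mult.assoc add.commute)
    moreover have "left_eval (\<lambda>m. v m * b) p = left_eval v p * b" for v :: "nat \<Rightarrow> 'a" and b p
      by (simp add: left_eval_def sum_distrib_right mult.assoc)
    ultimately show ?case
      by (simp add: mat_power_add matrix_matrix_mult_def eval_weight_sum zero)
  qed (simp_all add: left_eval_add distrib_right)
  then show ?thesis by (simp add: vec_eq_iff eval_mat_nth)
qed

text \<open>The usual proof of the Cayley-Hamilton theorem: \<open>p\<close> is divisible on the right by \<open>A - T\<close>, and
evaluation at \<open>A\<close> with coefficients on the left kills right multiples of \<open>A - T\<close>.\<close>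

lemma eval_mat_zero_of_left_factor:
  fixes A :: "'a::ring_1 ^ 'k ^ 'k"
  assumes adj: "\<And>l k. (\<Sum>i\<in>UNIV. Q l i * (pconst (A $ i $ k) - (if i = k then polyT else 0))) = (if l = k then p else 0)"
  shows "eval_mat p A = 0"
proof -
  have "left_eval (\<lambda>m. mat_power A m $ l $ j) p = 0" for l j
  proof -
    let ?w = "\<lambda>k m. mat_power A m $ k $ j"
    have "left_eval (?w l) p = (\<Sum>k\<in>UNIV. left_eval (?w k) (if l = k then p else 0))"
      by (simp add: if_distrib[where f = "left_eval w" for w] cong: if_cong)
    also have "\<dots> = (\<Sum>k\<in>UNIV. \<Sum>i\<in>UNIV. left_eval (?w k) (Q l i * pconst (A $ i $ k)))
        - (\<Sum>k\<in>UNIV. left_eval (?w k) (Q l k * polyT))"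
      unfolding adj[symmetric] eval_sum
      by (simp add: right_diff_distrib eval_diff eval_sum sum_subtractf if_distrib[where f = "\<lambda>x. b * x" for b] if_distrib[where f = "left_eval w" for w] cong: if_cong)
    also have "(\<Sum>k\<in>UNIV. \<Sum>i\<in>UNIV. left_eval (?w k) (Q l i * pconst (A $ i $ k))) =
        (\<Sum>i\<in>UNIV. left_eval (\<lambda>m. \<Sum>k\<in>UNIV. A $ i $ k * ?w k m) (Q l i))"
      unfolding eval_weight_sum eval_pconst by (rule sum.swap)
    also have "\<dots> = (\<Sum>k\<in>UNIV. left_eval (?w k) (Q l k * polyT))"
      unfolding eval_polyT by (simp add: matrix_matrix_mult_def)
    finally show ?thesis by simp
  qed
  then show ?thesis by (simp add: vec_eq_iff eval_mat_nth)
qed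

text \<open>Here \<open>A - T\<close> is a factor on the left, so it is evaluation with coefficients on the right that vanishes.
The coefficients of \<open>p\<close> itself commute with \<open>A\<close>, so both evaluations of \<open>p\<close> agree.\<close>

lemma eval_mat_zero_of_right_factor:
  fixes A :: "'a::ring_1 ^ 'k ^ 'k"
  assumes adj: "\<And>k l. (\<Sum>i\<in>UNIV. (pconst (A $ k $ i) - (if i = k then polyT else 0)) * Q i l) = (if k = l then p else 0)"
    and comm: "\<And>m i j. Poly_Mapping.lookup p m * A $ i $ j = A $ i $ j * Poly_Mapping.lookup p m"
  shows "eval_mat p A = 0"
proof -
  have "right_eval (\<lambda>m. mat_power A m $ j $ l) p = 0" for l j
  proof -
    let ?w = "\<lambda>k m. mat_power A m $ j $ k"
    have "right_eval (?w l) p = (\<Sum>k\<in>UNIV. right_eval (?w k) (if k = l then p else 0))"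
      by (simp add: if_distrib[where f = "right_eval w" for w] cong: if_cong)
    also have "\<dots> = (\<Sum>k\<in>UNIV. \<Sum>i\<in>UNIV. right_eval (?w k) (pconst (A $ k $ i) * Q i l))
        - (\<Sum>k\<in>UNIV. right_eval (?w k) (polyT * Q k l))"
      unfolding adj[symmetric] eval_sum
      by (simp add: left_diff_distrib eval_diff sum_subtractf if_distrib[where f = "\<lambda>x. x * b" for b] if_distrib[where f = "right_eval w" for w] cong: if_cong)
    also have "(\<Sum>k\<in>UNIV. \<Sum>i\<in>UNIV. right_eval (?w k) (pconst (A $ k $ i) * Q i l)) =
        (\<Sum>i\<in>UNIV. right_eval (\<lambda>m. \<Sum>k\<in>UNIV. ?w k m * A $ k $ i) (Q i l))"
      unfolding eval_weight_sum eval_pconst by (rule sum.swap)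
    also have "\<dots> = (\<Sum>k\<in>UNIV. right_eval (?w k) (polyT * Q k l))"
      unfolding eval_polyT mat_power_Suc_right by (simp add: matrix_matrix_mult_def)
    finally show ?thesis by simp
  qed
  moreover have "Poly_Mapping.lookup p m * mat_power A k $ i $ j = mat_power A k $ i $ j * Poly_Mapping.lookup p m" for m k i j
  proof (induction k arbitrary: i j)
    case (Suc k)
    have "Poly_Mapping.lookup p m * (A $ i $ l * mat_power A k $ l $ j) = A $ i $ l * mat_power A k $ l $ j * Poly_Mapping.lookup p m" for l
    proof -
      have "Poly_Mapping.lookup p m * (A $ i $ l * mat_power A k $ l $ j) =
          A $ i $ l * (Poly_Mapping.lookup p m * mat_power A k $ l $ j)"
        by (simp only: mult.assoc[symmetric] comm)
      then show ?thesis by (simp only: Suc mult.assoc)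
    qed
    then show ?case
      by (simp add: matrix_matrix_mult_def sum_distrib_left sum_distrib_right)
  qed (simp add: mat_def)
  ultimately show ?thesis
    by (simp add: vec_eq_iff eval_mat_nth left_eval_def right_eval_def)
qed


section \<open>Characteristic identities\<close>

text \<open>The adjugate identities have entries \<open>f - CARD('i) - T\<close> and (transposed) \<open>f - 1 - T\<close>: the
parameter starts at \<open>- T - 1\<close> in the first column and has dropped by \<open>CARD('i) - 1\<close> in the last.\<close>

lemma characteristic_identities:
  fixes f :: "'i::{finite, linorder} \<Rightarrow> 'i \<Rightarrow> 'a::ring_1"
  assumes gl: "\<And>i j k l. cmt (f i j) (f k l) = (if j = k then f i l else 0) - (if l = i then f k j else 0)"
  defines "D \<equiv> capelli_det (\<lambda>i j. pconst (f i j)) (- polyT - 1)"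
  shows "eval_mat D (\<chi> i j. f i j - (if i = j then of_nat CARD('i) else 0)) = 0"
    and "eval_mat D (\<chi> i j. f j i - (if i = j then 1 else 0)) = 0"
proof -
  let ?F = "\<lambda>i j. pconst (f i j)" and ?u = "- polyT - 1 :: nat \<Rightarrow>\<^sub>0 'a"
  interpret gl_matrix ?F by (rule gl_matrix_pconst[OF gl])
  have u: "central ?u"
    using polyT_central by (simp add: central_def algebra_simps)
  show "eval_mat D (\<chi> i j. f i j - (if i = j then of_nat CARD('i) else 0)) = 0" (is "eval_mat D ?A = 0")
  proof -
    \<comment> \<open>The parameter of the last column is \<open>- T - CARD('i)\<close>.\<close>
    have "?u - of_nat (CARD('i) - 1) = - polyT - of_nat CARD('i)"
      by (simp add: of_nat_diff)
    then have col: "shifted_col ?F (?u - of_nat (CARD('i) - 1)) k i = pconst (?A $ i $ k) - (if i = k then polyT else 0)" for i k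
      by (auto simp: shifted_col_def pconst_diff pconst_of_nat pconst_zero)
    obtain Q where "\<forall>l k. (\<Sum>i\<in>UNIV. Q l i * shifted_col ?F (?u - of_nat (CARD('i) - 1)) k i) = (if l = k then D else 0)"
      using capelli_left_adjugate[OF u] unfolding D_def ..
    then show ?thesis unfolding col by (intro eval_mat_zero_of_left_factor[where Q = Q]) blast
  qed
  show "eval_mat D (\<chi> i j. f j i - (if i = j then 1 else 0)) = 0" (is "eval_mat D ?A = 0")
  proof -
    have col: "shifted_col ?F ?u k i = pconst (?A $ k $ i) - (if i = k then polyT else 0)" for i k
      by (auto simp: shifted_col_def pconst_diff pconst_one pconst_zero)
    obtain Q where Q: "\<forall>k l. (\<Sum>i\<in>UNIV. shifted_col ?F ?u k i * Q i l) = (if k = l then D else 0)"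
      using capelli_right_adjugate[OF u] unfolding D_def ..
    have "Poly_Mapping.lookup (cmt (pconst (f i j)) D) m = 0" for i j m
      unfolding D_def by (simp add: cmt_capelli_det[OF u])
    then have "Poly_Mapping.lookup D m * f i j = f i j * Poly_Mapping.lookup D m" for m i j
      by (simp add: cmt_def lookup_minus lookup_pconst_mult)
    then have "Poly_Mapping.lookup D m * ?A $ i $ j = ?A $ i $ j * Poly_Mapping.lookup D m" for m i j
      by (simp add: right_diff_distrib left_diff_distrib)
    then show ?thesis
      using Q unfolding col by (intro eval_mat_zero_of_right_factor[where Q = Q]) blast+
  qed
qed


section \<open>Factorization of C_rho\<close>

text \<open>Since \<open>R1\<close> is central, adding it on the diagonal preserves the commutation relations.\<close>

definition gl_shifted :: "'n::finite \<Rightarrow> 'n \<Rightarrow> 'n target" where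
  "gl_shifted i j = 1 \<otimes> E i j + (if i = j then R1 else 0)"

lemma cmt_R1_E: "cmt R1 (1 \<otimes> E i j) = 0"
  by (rule R1_tens) (simp_all add: cmt_one G_E)

lemma cmt_R1_t_quot: "cmt R1 (t_quot a \<otimes> 1) = 0"
  by (rule R1_tens) (simp_all add: cmt_one euler_t_quot)

lemma gl_shifted_relation:
  "cmt (gl_shifted i j) (gl_shifted k l) =
    (if j = k then gl_shifted i l else 0) - (if l = i then gl_shifted k j else 0)"
proof -
  have "cmt (1 \<otimes> E i j) R1 = 0" for i j :: 'a
    using cmt_R1_E[of i j] by (simp add: cmt_commute[of _ R1])
  then have "cmt (gl_shifted i j) (gl_shifted k l) = 1 \<otimes> cmt (E i j) (E k l)"
    by (simp add: gl_shifted_def cmt_simps cmt_R1_E cmt_tens2) (simp add: cmt_def)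
  then show ?thesis
    by (auto simp: gl_shifted_def E_cmt tens_diff tens_zero)
qed

lemma t_quot_t_pd: "t_quot c * t_pd None b = t_pd c b"
proof (transfer fixing: b c)
  have "t0_inv * (tvar None * pd b p) = pd b p" for p
  proof -
    have "t0_inv * (tvar None * pd b p) = (tvar None * t0_inv) * pd b p"
      by (simp only: mult_ac)
    then show ?thesis by (simp only: tvar_t0_inv mult_1)
  qed
  then show "(\<lambda>p. tvar c * t0_inv * (tvar None * pd b p)) = (\<lambda>p. tvar c * pd b p)"
    by (simp only: mult.assoc)
qed

text \<open>Both sides are \<open>t\<^sub>a t\<^sub>b / t\<^sub>0\<close> times the derivation by \<open>t\<^sub>b\<close>.\<close>

lemma t_quot_t_pd_swap: "t_quot b * t_pd a b = t_quot a * t_pd b b"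
proof -
  have "t_quot b * t_pd a b = (t_quot b * t_quot a) * t_pd None b"
    by (simp only: mult.assoc t_quot_t_pd)
  also have "\<dots> = t_quot a * t_pd b b"
    by (simp only: t_quot_commute[of b a] mult.assoc t_quot_t_pd)
  finally show ?thesis .
qed

lemma sum_UNIV_option: "(\<Sum>b\<in>UNIV. g b) = g None + (\<Sum>i\<in>UNIV. g (Some i))"
  for g :: "'n::finite option \<Rightarrow> 'b::comm_monoid_add"
  by (simp add: UNIV_option_conv sum.reindex)

text \<open>With \<open>t\<^sub>0 / t\<^sub>0 = 1\<close> this is the action of the matrix of the \<open>rho_gen a b\<close> on the vector of the \<open>t\<^sub>b / t\<^sub>0\<close>.
The differential operators sum to the Euler operator, and the term
\<open>- (\<Sum>i. t_over_t0 i \<otimes> E a i)\<close> in \<open>rho_gen (Some a) None\<close> is there to cancel the \<open>gl(n)\<close> part.\<close>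

lemma rho_gen_times_t_quot:
  "rho_gen a None + (\<Sum>i\<in>UNIV. (t_quot (Some i) \<otimes> 1) * rho_gen a (Some i)) = (euler \<otimes> 1 + R1) * (t_quot a \<otimes> 1)"
proof -
  have "rho_gen a None + (\<Sum>i\<in>UNIV. (t_quot (Some i) \<otimes> 1) * rho_gen a (Some i)) =
      (\<Sum>b\<in>UNIV. (t_quot b \<otimes> 1) * rho_gen a b)"
    by (simp add: sum_UNIV_option t_quot_None tens_one)
  also have "\<dots> = (\<Sum>b\<in>UNIV. (t_quot b * t_pd a b) \<otimes> 1) + (\<Sum>b\<in>UNIV. (t_quot b \<otimes> 1) * rho_core a b) +
      (\<Sum>b\<in>UNIV. if a = b then (t_quot a \<otimes> 1) * R1 else 0)"
    unfolding rho_gen_core sum.distrib[symmetric]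
    by (rule sum.cong) (auto simp: distrib_left tens_mult)
  also have "(\<Sum>b\<in>UNIV. (t_quot b * t_pd a b) \<otimes> 1) = (t_quot a * euler) \<otimes> 1"
    unfolding euler_def sum_distrib_left tens_sum
    by (intro sum.cong refl arg_cong[where f = "\<lambda>z. z \<otimes> 1"] t_quot_t_pd_swap)
  also have "t_quot a * euler = euler * t_quot a"
    using euler_t_quot[of a] by (simp add: cmt_def)
  also have "(\<Sum>b\<in>UNIV. (t_quot b \<otimes> 1) * rho_core a b) = 0"
    by (cases a) (simp_all add: sum_UNIV_option t_quot_None tens_one tens_mult flip: t_quot_Some)
  also have "(\<Sum>b\<in>UNIV. if a = b then (t_quot a \<otimes> 1) * R1 else 0) = R1 * (t_quot a \<otimes> 1)"
    using cmt_R1_t_quot[of a] by (simp add: cmt_def)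
  finally show ?thesis
    by (simp add: distrib_right tens_mult)
qed

text \<open>Up to a matrix in \<open>gl(n)\<close> extended by a zero row, the columns of index \<open>Some b\<close> are multiples of the one
vector with entries \<open>t\<^sub>a / t\<^sub>0\<close>, since \<open>t\<^sub>a \<partial>\<^sub>b = (t\<^sub>a / t\<^sub>0) (t\<^sub>0 \<partial>\<^sub>b)\<close>.\<close>

lemma C_rho_factorization:
  "(C_rho :: nat \<Rightarrow>\<^sub>0 'n::{finite, linorder} target) =
    (pconst (euler \<otimes> 1 + R1) - polyT) * capelli_det (\<lambda>i j. pconst (gl_shifted i j)) (- polyT - 1)"
proof -
  let ?M = "\<lambda>a b. pconst (rho_gen a b) :: nat \<Rightarrow>\<^sub>0 'n target"
    and ?x = "\<lambda>a. pconst (t_quot a \<otimes> 1) :: nat \<Rightarrow>\<^sub>0 'n target"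
    and ?N = "\<lambda>a b. pconst (gl_shifted a b) :: nat \<Rightarrow>\<^sub>0 'n target"
    and ?d = "\<lambda>b. pconst (t_pd None (Some b) \<otimes> 1) :: nat \<Rightarrow>\<^sub>0 'n target"
    and ?S = "pconst (euler \<otimes> 1 + R1) :: nat \<Rightarrow>\<^sub>0 'n target"
  have "C_rho = col_det (\<lambda>a b. ?M a b - (if a = b then polyT + of_nat (index a) else 0))"
    unfolding C_rho_def capelli_def map_col_det_shifted[OF rho_hom(1)] rho_hom(2) ..
  also have "\<dots> = capelli_det ?M (- polyT)"
    by (rule col_det_eq_capelli_det)
  also have "\<dots> = (?S + - polyT) * capelli_det ?N (- polyT - 1)"
  proof (rule capelli_det_factor[where x = ?x and d = ?d])
    show "gl_matrix ?M"
      by (rule gl_matrix_pconst[OF rho_gen_rel])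
    show "central (- polyT :: nat \<Rightarrow>\<^sub>0 'n target)"
      using polyT_central by (simp add: central_def)
    show "?x None = 1"
      by (simp add: t_quot_None tens_one pconst_one)
    show "?x a * ?x b = ?x b * ?x a" for a b
      unfolding pconst_mult[symmetric] tens_mult t_quot_commute[of a b] ..
    show "?M a (Some b) = zero_row (\<lambda>a. ?N a b) a + ?x a * ?d b" for a b
      unfolding pconst_mult[symmetric] tens_mult t_quot_t_pd
      by (cases a) (simp_all add: gl_shifted_def add_ac flip: pconst_add)
    show "?x c * ?N a b = ?N a b * ?x c" for a b c
    proof -
      have "(t_quot c \<otimes> 1) * gl_shifted a b = gl_shifted a b * (t_quot c \<otimes> 1)"
        using cmt_R1_t_quot[of c] by (simp add: gl_shifted_def distrib_left distrib_right tens_mult cmt_def)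
      then show ?thesis by (simp flip: pconst_mult)
    qed
    show "?M a None + (\<Sum>i\<in>UNIV. ?x (Some i) * ?M a (Some i)) = ?S * ?x a" for a
      unfolding pconst_mult[symmetric] pconst_sum[symmetric] pconst_add[symmetric] rho_gen_times_t_quot ..
  qed
  finally show ?thesis by simp
qed

theorem corollary5p3:
  "eval_mat C_rho (E_mat + mat (R1 - of_nat CARD('n::{finite, linorder}))
      :: 'n::{finite, linorder} target ^ 'n::{finite, linorder} ^ 'n::{finite, linorder}) = 0 \<and>
   eval_mat C_rho (Finite_Cartesian_Product.transpose E_mat - mat 1 + mat R1
      :: 'n::{finite, linorder} target ^ 'n::{finite, linorder} ^ 'n::{finite, linorder}) = 0"
proof
  have 1: "E_mat + mat (R1 - of_nat CARD('n::{finite, linorder})) =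
      ((\<chi> i j. gl_shifted i j - (if i = j then of_nat CARD('n::{finite, linorder}) else 0)) :: 'n::{finite, linorder} target ^ 'n::{finite, linorder} ^ 'n::{finite, linorder})"
    by (simp add: vec_eq_iff E_mat_def mat_def gl_shifted_def)
  show "eval_mat C_rho (E_mat + mat (R1 - of_nat CARD('n::{finite, linorder})) :: 'n::{finite, linorder} target ^ 'n::{finite, linorder} ^ 'n::{finite, linorder}) = 0"
    unfolding 1 C_rho_factorization
    by (intro eval_mat_mult characteristic_identities gl_shifted_relation)
  have 2: "Finite_Cartesian_Product.transpose E_mat - mat 1 + mat R1 =
      ((\<chi> i j. gl_shifted j i - (if i = j then 1 else 0)) :: 'n::{finite, linorder} target ^ 'n::{finite, linorder} ^ 'n::{finite, linorder})"
    by (simp add: vec_eq_iff E_mat_def mat_def gl_shifted_def Finite_Cartesian_Product.transpose_def)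
  show "eval_mat C_rho (Finite_Cartesian_Product.transpose E_mat - mat 1 + mat R1 :: 'n::{finite, linorder} target ^ 'n::{finite, linorder} ^ 'n::{finite, linorder}) = 0"
    unfolding 2 C_rho_factorization
    by (intro eval_mat_mult characteristic_identities gl_shifted_relation)
qed

end
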